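(* Let $\kappa$ be a singular cardinal of cofinality $\omega_1$, and let $\mathbb{P}$ be any of $\mathbb{L}_\kappa$, $\mathbb{L}^{\mathrm{stat}}_\kappa$, $\mathbb{L}^{\mathrm{club}}_\kappa$. Then $\mathrm{Add}(\omega_1,1)\lessdot\mathbb{P}$.
   Context: Let $\lambda=\omega_1$ and fix a strictly increasing sequence $\langle\kappa_\alpha:\alpha<\lambda\rangle$ of regular infinite cardinals with supremum $\kappa$. Let $N=\bigcup_{\alpha<\lambda}\prod_{\beta<\alpha}\kappa_\beta$ (functions $t$ with $\mathrm{dom}(t)$ an ordinal $<\lambda$ and $t(\beta)<\kappa_\beta$), ordered by end-extension $\sqsubseteq$. A tree is a nonempty $T\subseteq N$ closed under initial segments; $\mathrm{Succ}_T(t)$ and $\mathrm{OSucc}_T(t)=\{\beta:t^\frown\langle\beta\rangle\in T\}$ denote the immediate successors and ordinal successor set. $T$ is $(<\lambda)$-closed if every node has a proper extension in $T$ and whenever $\delta<\lambda$ is a limit and $f$ has domain $\delta$ with $f\restriction\beta\in T$ for all $\beta<\delta$, then $f\in T$. $\mathbb{L}_\kappa$ consists of $(<\lambda)$-closed trees $p$ with a node $s$ (the stem) comparable with every node of $p$ such that every $t\in p$ with $s\sqsubseteq t$ satisfies $|\mathrm{Succ}_p(t)|=\kappa_{\mathrm{dom}(t)}$; $\mathbb{L}^{\mathrm{stat}}_\kappa$ (resp. $\mathbb{L}^{\mathrm{club}}_\kappa$) additionally requires $\mathrm{OSucc}_p(t)$ to be a stationary subset of $\{\beta<\kappa_{\mathrm{dom}(t)}:\operatorname{cf}\beta=\omega\}$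 (resp. to contain a club subset of $\kappa_{\mathrm{dom}(t)}$) for all such $t$; all ordered by inclusion. $\mathrm{Add}(\omega_1,1)$ is the poset of partial functions from $\omega_1$ to $2$ with countable domain, ordered by reverse inclusion. For posets $\mathbb{Q},\mathbb{P}$, $\mathbb{Q}\lessdot\mathbb{P}$ means that the regular open algebra $\mathrm{ro}(\mathbb{Q})$ is isomorphic to a complete subalgebra of $\mathrm{ro}(\mathbb{P})$. *)

theory Defs
  imports "HOL-Analysis.Abstract_Topology"
begin

unbundle cardinal_syntax

section \<open>Ordinals and cardinals inside a well-ordered type\<close>

text \<open>
  The cardinal \<open>\<kappa>\<close> is given as a type \<open>'a\<close> of class \<open>wellorder\<close> whose order \<open>whole_rel\<close> is an
  initial ordinal. The elements of \<open>'a\<close> are the ordinals below \<open>\<kappa>\<close>; the ordinal \<open>a\<close> is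
  identified with the set \<open>{..<a}\<close> of its predecessors, well-ordered by \<open>below_rel a\<close>.
  Thus \<open>r =o c\<close> says that \<open>r\<close> and \<open>c\<close> have the same order type; \<open>natLeq\<close> is \<open>\<omega>\<close>
  and \<open>cardSuc natLeq\<close> is \<open>\<omega>\<^sub>1\<close>.
\<close>

definition whole_rel :: "'a::wellorder rel" where
  "whole_rel = {(x, y). x \<le> y}"

definition below_rel :: "'a::wellorder \<Rightarrow> 'a rel" where
  "below_rel a = {(x, y). x \<le> y \<and> y < a}"

definition infinite_cardinal :: "'a rel \<Rightarrow> bool" where
  "infinite_cardinal r \<longleftrightarrow> Card_order r \<and> infinite (Field r)"

definition regular_cardinal :: "'a rel \<Rightarrow> bool" where
  "regular_cardinal r \<longleftrightarrow> infinite_cardinal r \<and> regularCard r"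

definition singular_cardinal :: "'a rel \<Rightarrow> bool" where
  "singular_cardinal r \<longleftrightarrow> infinite_cardinal r \<and> \<not> regularCard r"

text \<open>
  The library's \<open>cofinal K r\<close> asks for strict upper bounds. So a successor ordinal has no
  cofinal set and no cofinality in this sense, which is harmless for infinite cofinalities.
\<close>

definition has_cofinality :: "'a rel \<Rightarrow> 'b rel \<Rightarrow> bool" where
  "has_cofinality r c \<longleftrightarrow>
     (\<exists>K. K \<subseteq> Field r \<and> cofinal K r \<and> |K| =o c) \<and>
     (\<forall>K. K \<subseteq> Field r \<and> cofinal K r \<longrightarrow> c \<le>o |K| )"

definition limit_ordinal :: "'a::wellorder \<Rightarrow> bool" where
  "limit_ordinal d \<longleftrightarrow> (\<exists>b. b < d) \<and> (\<forall>b<d. \<exists>c. b < c \<and> c < d)"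

definition club_in :: "'a::wellorder set \<Rightarrow> 'a \<Rightarrow> bool" where
  "club_in C m \<longleftrightarrow> C \<subseteq> {..<m} \<and>
     (\<forall>b<m. \<exists>c\<in>C. b < c) \<and>
     (\<forall>d<m. limit_ordinal d \<and> (\<forall>b<d. \<exists>c\<in>C. b < c \<and> c < d) \<longrightarrow> d \<in> C)"

definition stationary_in :: "'a::wellorder set \<Rightarrow> 'a \<Rightarrow> bool" where
  "stationary_in S m \<longleftrightarrow> S \<subseteq> {..<m} \<and> (\<forall>C. club_in C m \<longrightarrow> S \<inter> C \<noteq> {})"


section \<open>Trees\<close>

text \<open>
  Sequences of ordinal length are partial maps whose domain is an initial segment \<open>{..<a}\<close>;
  on these, end-extension is \<open>\<subseteq>\<^sub>m\<close>. Below, \<open>lam\<close> is the height \<open>\<lambda>\<close> and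
  \<open>ks\<close> the sequence of the \<open>\<kappa>\<^sub>\<alpha>\<close>; only the values \<open>ks a\<close> with \<open>a < lam\<close> matter.
\<close>

definition nodes :: "'a::wellorder \<Rightarrow> ('a \<Rightarrow> 'a) \<Rightarrow> ('a \<rightharpoonup> 'a) set" where
  "nodes lam ks = {t. \<exists>a<lam. dom t = {..<a} \<and> (\<forall>b<a. the (t b) < ks b)}"

definition len :: "('a::wellorder \<rightharpoonup> 'a) \<Rightarrow> 'a" where
  "len t = (THE a. dom t = {..<a})"

lemma len_eq:
  assumes "dom t = {..<a}"
  shows "len t = a"
  unfolding len_def using assms by (auto intro!: the_equality)

definition is_tree :: "'a::wellorder \<Rightarrow> ('a \<Rightarrow> 'a) \<Rightarrow> ('a \<rightharpoonup> 'a) set \<Rightarrow> bool" where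
  "is_tree lam ks T \<longleftrightarrow> T \<noteq> {} \<and> T \<subseteq> nodes lam ks \<and>
     (\<forall>t\<in>T. \<forall>s\<in>nodes lam ks. s \<subseteq>\<^sub>m t \<longrightarrow> s \<in> T)"

definition Succ :: "('a \<rightharpoonup> 'a) set \<Rightarrow> ('a \<rightharpoonup> 'a) \<Rightarrow> ('a \<rightharpoonup> 'a) set" where
  "Succ T t = {u \<in> T. t \<subseteq>\<^sub>m u \<and> t \<noteq> u \<and>
                     (\<forall>v\<in>T. t \<subseteq>\<^sub>m v \<and> v \<subseteq>\<^sub>m u \<longrightarrow> v = t \<or> v = u)}"

definition OSucc :: "('a::wellorder \<rightharpoonup> 'a) set \<Rightarrow> ('a \<rightharpoonup> 'a) \<Rightarrow> 'a set" where
  "OSucc T t = {b. t(len t \<mapsto> b) \<in> T}"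

definition closed_tree :: "'a::wellorder \<Rightarrow> ('a \<Rightarrow> 'a) \<Rightarrow> ('a \<rightharpoonup> 'a) set \<Rightarrow> bool" where
  "closed_tree lam ks T \<longleftrightarrow> is_tree lam ks T \<and>
     (\<forall>t\<in>T. \<exists>u\<in>T. t \<subseteq>\<^sub>m u \<and> t \<noteq> u) \<and>
     (\<forall>d<lam. limit_ordinal d \<longrightarrow>
        (\<forall>f. dom f = {..<d} \<and> (\<forall>b<d. f |` {..<b} \<in> T) \<longrightarrow> f \<in> T))"


section \<open>The forcing notions\<close>

definition is_stem :: "('a::wellorder \<Rightarrow> 'a) \<Rightarrow> ('a \<rightharpoonup> 'a) set \<Rightarrow> ('a \<rightharpoonup> 'a) \<Rightarrow> bool" where
  "is_stem ks p s \<longleftrightarrow> s \<in> p \<and> (\<forall>t\<in>p. t \<subseteq>\<^sub>m s \<or> s \<subseteq>\<^sub>m t) \<and>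
     (\<forall>t\<in>p. s \<subseteq>\<^sub>m t \<longrightarrow> |Succ p t| =o below_rel (ks (len t)))"

definition Laver :: "'a::wellorder \<Rightarrow> ('a \<Rightarrow> 'a) \<Rightarrow> ('a \<rightharpoonup> 'a) set set" where
  "Laver lam ks = {p. closed_tree lam ks p \<and> (\<exists>s. is_stem ks p s)}"

definition Laver_stat :: "'a::wellorder \<Rightarrow> ('a \<Rightarrow> 'a) \<Rightarrow> ('a \<rightharpoonup> 'a) set set" where
  "Laver_stat lam ks = {p. closed_tree lam ks p \<and>
     (\<exists>s. is_stem ks p s \<and>
        (\<forall>t\<in>p. s \<subseteq>\<^sub>m t \<longrightarrow>
           OSucc p t \<subseteq> {b. b < ks (len t) \<and> has_cofinality (below_rel b) natLeq} \<and>
           stationary_in (OSucc p t) (ks (len t))))}"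

definition Laver_club :: "'a::wellorder \<Rightarrow> ('a \<Rightarrow> 'a) \<Rightarrow> ('a \<rightharpoonup> 'a) set set" where
  "Laver_club lam ks = {p. closed_tree lam ks p \<and>
     (\<exists>s. is_stem ks p s \<and>
        (\<forall>t\<in>p. s \<subseteq>\<^sub>m t \<longrightarrow> (\<exists>C. club_in C (ks (len t)) \<and> C \<subseteq> OSucc p t)))}"

text \<open>For \<open>lam = \<omega>\<^sub>1\<close> this is \<open>Add(\<omega>\<^sub>1,1)\<close>; its order is \<open>\<lambda>q p. p \<subseteq>\<^sub>m q\<close>.\<close>

definition Add :: "'a::wellorder \<Rightarrow> ('a \<rightharpoonup> bool) set" where
  "Add lam = {p. dom p \<subseteq> {..<lam} \<and> countable (dom p)}"


section \<open>Regular open algebras and complete subalgebras\<close>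

text \<open>A poset carries the topology whose open sets are the downward closed sets.\<close>

definition poset_topology :: "'p set \<Rightarrow> ('p \<Rightarrow> 'p \<Rightarrow> bool) \<Rightarrow> 'p topology" where
  "poset_topology P le =
     topology (\<lambda>U. U \<subseteq> P \<and> (\<forall>p\<in>U. \<forall>q\<in>P. le q p \<longrightarrow> q \<in> U))"

lemma openin_poset_topology:
  "openin (poset_topology P le) U \<longleftrightarrow> U \<subseteq> P \<and> (\<forall>p\<in>U. \<forall>q\<in>P. le q p \<longrightarrow> q \<in> U)"
proof -
  have "istopology (\<lambda>U. U \<subseteq> P \<and> (\<forall>p\<in>U. \<forall>q\<in>P. le q p \<longrightarrow> q \<in> U))"
    unfolding istopology_def by blast
  then show ?thesis
    unfolding poset_topology_def by simp
qed

definition ro :: "'p topology \<Rightarrow> 'p set set" where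
  "ro X = {U. X interior_of (X closure_of U) = U}"

definition ro_sup :: "'p topology \<Rightarrow> 'p set set \<Rightarrow> 'p set" where
  "ro_sup X \<U> = X interior_of (X closure_of (\<Union>\<U>))"

definition ro_compl :: "'p topology \<Rightarrow> 'p set \<Rightarrow> 'p set" where
  "ro_compl X U = X interior_of (topspace X - U)"

text \<open>
  Meets are intersections. Closure under complements and arbitrary suprema (of the ambient
  algebra) gives \<open>0\<close>, \<open>1\<close> and arbitrary infima.
\<close>

definition complete_subalgebra :: "'p topology \<Rightarrow> 'p set set \<Rightarrow> bool" where
  "complete_subalgebra X \<B> \<longleftrightarrow> \<B> \<subseteq> ro X \<and>
     (\<forall>U\<in>\<B>. ro_compl X U \<in> \<B>) \<and> (\<forall>\<U>. \<U> \<subseteq> \<B> \<longrightarrow> ro_sup X \<U> \<in> \<B>)"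

definition ro_isomorphism ::
  "'q topology \<Rightarrow> 'p topology \<Rightarrow> 'p set set \<Rightarrow> ('q set \<Rightarrow> 'p set) \<Rightarrow> bool" where
  "ro_isomorphism Y X \<B> h \<longleftrightarrow> bij_betw h (ro Y) \<B> \<and>
     (\<forall>U\<in>ro Y. h (ro_compl Y U) = ro_compl X (h U)) \<and>
     (\<forall>U\<in>ro Y. \<forall>V\<in>ro Y. h (U \<inter> V) = h U \<inter> h V \<and>
                          h (ro_sup Y {U, V}) = ro_sup X {h U, h V})"

definition completely_embeds ::
  "'q set \<Rightarrow> ('q \<Rightarrow> 'q \<Rightarrow> bool) \<Rightarrow> 'p set \<Rightarrow> ('p \<Rightarrow> 'p \<Rightarrow> bool) \<Rightarrow> bool" where
  "completely_embeds Q leQ P leP \<longleftrightarrow>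
     (\<exists>\<B> h. complete_subalgebra (poset_topology P leP) \<B> \<and>
            ro_isomorphism (poset_topology Q leQ) (poset_topology P leP) \<B> h)"

end

theory Submission
  imports Defs "HOL-Library.Countable_Set_Type"
begin

text \<open>
  The stem of a condition is mapped to a condition of \<open>Add(\<omega>\<^sub>1,1)\<close> by reading off a bit at each
  limit level \<open>\<delta>\<close>; this is a projection once every node above the stem of every Laver tree can be
  extended inside the tree to length \<open>\<delta>\<close> with either bit at \<open>\<delta>\<close> (closure of the tree
  under limits then allows all bits of countably many levels to be prescribed).

  To define the bit at \<open>\<delta>\<close>, fix a ladder \<open>\<delta>\<^sub>n\<close> converging to \<open>\<delta>\<close> and restrict
  a node to it, which gives an element \<open>f\<close> of \<open>\<Prod>\<^sub>n \<mu>\<^sub>n\<close> with \<open>\<mu>\<^sub>n = \<kappa>\<^bsub>\<delta>\<^sub>n\<^esub>\<close>. Let \<open>\<theta>\<close> be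
  the least size of a family that is unbounded modulo finite in this product, let
  \<open>(h\<^sub>\<xi>)\<close>, \<open>\<xi> < \<theta>\<close>, be an increasing unbounded chain, and let the owner of \<open>f\<close> be the least \<open>\<xi>\<close>
  with \<open>h\<^sub>\<xi> \<not>\<le>\<^sup>* f\<close>. A tree has fewer than \<open>\<mu>\<^sub>n\<close> relevant nodes at stage \<open>n\<close>, so by
  regularity of \<open>\<mu>\<^sub>n\<close> there is a club of \<open>\<xi> < \<theta>\<close> whose members of cofinality \<open>\<omega>\<close> all own
  a branch of the tree. The bit tells whether the owner lies in a fixed stationary set of points of
  cofinality \<open>\<omega>\<close> whose complement in these points is stationary as well.
\<close>

section \<open>Projections and regular open algebras\<close>

lemma topspace_poset_topology [simp]:
  "topspace (poset_topology P le) = P"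
proof
  show "topspace (poset_topology P le) \<subseteq> P"
    unfolding topspace_def by (auto simp: openin_poset_topology)
  show "P \<subseteq> topspace (poset_topology P le)"
    using openin_subset[of "poset_topology P le" P] by (simp add: openin_poset_topology)
qed

locale preordered_set =
  fixes P :: "'p set" and le :: "'p \<Rightarrow> 'p \<Rightarrow> bool"
  assumes refl: "\<And>p. p \<in> P \<Longrightarrow> le p p"
    and trans: "\<And>p q r. le p q \<Longrightarrow> le q r \<Longrightarrow> le p r"
begin

lemma openin_cone: "openin (poset_topology P le) {q \<in> P. le q p}"
  unfolding openin_poset_topology using trans by blast

text \<open>The cone below \<open>p\<close> is the least open set containing \<open>p\<close>, so
  interior and closure are decided by looking at that cone alone.\<close>

lemma interior_of_poset_topology:
  "poset_topology P le interior_of S = {p \<in> P. \<forall>q\<in>P. le q p \<longrightarrow> q \<in> S}"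
proof (intro set_eqI iffI)
  fix p assume "p \<in> poset_topology P le interior_of S"
  then show "p \<in> {p \<in> P. \<forall>q\<in>P. le q p \<longrightarrow> q \<in> S}"
    unfolding interior_of_def by (auto simp: openin_poset_topology)
next
  fix p assume "p \<in> {p \<in> P. \<forall>q\<in>P. le q p \<longrightarrow> q \<in> S}"
  then show "p \<in> poset_topology P le interior_of S"
    unfolding interior_of_def using openin_cone[of p] refl by blast
qed

lemma closure_of_poset_topology:
  "poset_topology P le closure_of S = {p \<in> P. \<exists>q\<in>P. le q p \<and> q \<in> S}"
proof (intro set_eqI iffI)
  fix p assume "p \<in> poset_topology P le closure_of S"
  then have p: "p \<in> P" "\<And>T. p \<in> T \<Longrightarrow> openin (poset_topology P le) T \<Longrightarrow> \<exists>y. y \<in> S \<and> y \<in> T"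
    unfolding in_closure_of by auto
  show "p \<in> {p \<in> P. \<exists>q\<in>P. le q p \<and> q \<in> S}"
    using p(1) p(2)[OF _ openin_cone[of p]] refl[OF p(1)] by blast
next
  fix p assume "p \<in> {p \<in> P. \<exists>q\<in>P. le q p \<and> q \<in> S}"
  then show "p \<in> poset_topology P le closure_of S"
    unfolding in_closure_of by (auto simp: openin_poset_topology)
qed

lemma interior_closure_poset_topology:
  "poset_topology P le interior_of (poset_topology P le closure_of S) =
     {p \<in> P. \<forall>q\<in>P. le q p \<longrightarrow> (\<exists>r\<in>P. le r q \<and> r \<in> S)}"
  unfolding interior_of_poset_topology closure_of_poset_topology by blast

lemma in_ro_poset_topology:
  "U \<in> ro (poset_topology P le) \<longleftrightarrow>
     U = {p \<in> P. \<forall>q\<in>P. le q p \<longrightarrow> (\<exists>r\<in>P. le r q \<and> r \<in> U)}"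
  unfolding ro_def interior_closure_poset_topology by auto

lemma ro_poset_topologyD:
  assumes "U \<in> ro (poset_topology P le)"
  shows "U \<subseteq> P"
    and "\<And>p q. \<lbrakk>p \<in> U; q \<in> P; le q p\<rbrakk> \<Longrightarrow> q \<in> U"
    and "\<And>p. \<lbrakk>p \<in> P; \<And>q. \<lbrakk>q \<in> P; le q p\<rbrakk> \<Longrightarrow> \<exists>r\<in>P. le r q \<and> r \<in> U\<rbrakk> \<Longrightarrow> p \<in> U"
proof -
  have U: "p \<in> U \<longleftrightarrow> p \<in> P \<and> (\<forall>q\<in>P. le q p \<longrightarrow> (\<exists>r\<in>P. le r q \<and> r \<in> U))" for p
    using assms unfolding in_ro_poset_topology by blast
  show "U \<subseteq> P" using U by blast
  show "q \<in> U" if "p \<in> U" "q \<in> P" "le q p" for p q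
    using that U[of p] U[of q] trans by blast
  show "p \<in> U" if "p \<in> P" "\<And>q. \<lbrakk>q \<in> P; le q p\<rbrakk> \<Longrightarrow> \<exists>r\<in>P. le r q \<and> r \<in> U" for p
    using that U[of p] by blast
qed

lemma ro_sup_poset_topology:
  "ro_sup (poset_topology P le) \<U> =
     {p \<in> P. \<forall>q\<in>P. le q p \<longrightarrow> (\<exists>r\<in>P. le r q \<and> r \<in> \<Union>\<U>)}"
  unfolding ro_sup_def interior_closure_poset_topology by simp

lemma ro_compl_poset_topology:
  "ro_compl (poset_topology P le) U = {p \<in> P. \<forall>q\<in>P. le q p \<longrightarrow> q \<notin> U}"
  unfolding ro_compl_def interior_of_poset_topology by auto

text \<open>Density below densely many conditions below \<open>p\<close> is density below
  \<open>p\<close>, so adding the points below which a set is dense reaches a fixed point after one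
  step.\<close>

lemma ro_sup_in_ro:
  "ro_sup (poset_topology P le) \<U> \<in> ro (poset_topology P le)"
proof -
  let ?D = "{p \<in> P. \<forall>q\<in>P. le q p \<longrightarrow> (\<exists>r\<in>P. le r q \<and> r \<in> \<Union>\<U>)}"
  have "p \<in> ?D \<longleftrightarrow> p \<in> P \<and> (\<forall>q\<in>P. le q p \<longrightarrow> (\<exists>r\<in>P. le r q \<and> r \<in> ?D))" for p
  proof
    assume p: "p \<in> ?D"
    have "q \<in> ?D" if "q \<in> P" "le q p" for q
      using p that(1) trans[OF _ that(2)] by blast
    then show "p \<in> P \<and> (\<forall>q\<in>P. le q p \<longrightarrow> (\<exists>r\<in>P. le r q \<and> r \<in> ?D))"
      using p refl by blast
  next
    assume p: "p \<in> P \<and> (\<forall>q\<in>P. le q p \<longrightarrow> (\<exists>r\<in>P. le r q \<and> r \<in> ?D))"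
    have "\<exists>r\<in>P. le r q \<and> r \<in> \<Union>\<U>" if q: "q \<in> P" "le q p" for q
    proof -
      obtain r where r: "r \<in> P" "le r q" "r \<in> ?D" using p q by blast
      then obtain s where "s \<in> P" "le s r" "s \<in> \<Union>\<U>" using refl by blast
      then show ?thesis using trans r(2) by blast
    qed
    then show "p \<in> ?D" using p by blast
  qed
  then show ?thesis
    unfolding in_ro_poset_topology ro_sup_poset_topology by blast
qed

lemma ro_compl_in_ro:
  assumes "U \<in> ro (poset_topology P le)"
  shows "ro_compl (poset_topology P le) U \<in> ro (poset_topology P le)"
proof -
  let ?D = "{p \<in> P. \<forall>q\<in>P. le q p \<longrightarrow> q \<notin> U}"
  have "p \<in> ?D \<longleftrightarrow> p \<in> P \<and> (\<forall>q\<in>P. le q p \<longrightarrow> (\<exists>r\<in>P. le r q \<and> r \<in> ?D))" for p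
  proof
    assume p: "p \<in> ?D"
    have "q \<in> ?D" if "q \<in> P" "le q p" for q
      using p that(1) trans[OF _ that(2)] by blast
    then show "p \<in> P \<and> (\<forall>q\<in>P. le q p \<longrightarrow> (\<exists>r\<in>P. le r q \<and> r \<in> ?D))"
      using p refl by blast
  next
    assume p: "p \<in> P \<and> (\<forall>q\<in>P. le q p \<longrightarrow> (\<exists>r\<in>P. le r q \<and> r \<in> ?D))"
    have "q \<notin> U" if q: "q \<in> P" "le q p" for q
    proof
      assume "q \<in> U"
      obtain r where r: "r \<in> P" "le r q" "r \<in> ?D" using p q by blast
      then show False using ro_poset_topologyD(2)[OF assms \<open>q \<in> U\<close>] refl by blast
    qed
    then show "p \<in> ?D" using p by blast
  qed
  then show ?thesis
    unfolding in_ro_poset_topology ro_compl_poset_topology by blast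
qed

end

text \<open>Preimages under \<open>\<pi>\<close> give the embedding. Monotonicity and the lifting
  property \<open>proj\<close> make density below \<open>\<pi> p\<close> equivalent to density of
  the preimage below \<open>p\<close>, which yields complements and suprema; \<open>dense\<close>
  makes the map injective.\<close>

lemma projection_completely_embeds:
  fixes \<pi> :: "'p \<Rightarrow> 'q"
  assumes reflP: "\<And>p. p \<in> P \<Longrightarrow> leP p p"
    and transP: "\<And>p q r. leP p q \<Longrightarrow> leP q r \<Longrightarrow> leP p r"
    and reflQ: "\<And>p. p \<in> Q \<Longrightarrow> leQ p p"
    and transQ: "\<And>p q r. leQ p q \<Longrightarrow> leQ q r \<Longrightarrow> leQ p r"
    and \<pi>: "\<And>p. p \<in> P \<Longrightarrow> \<pi> p \<in> Q"
    and mono: "\<And>p q. \<lbrakk>p \<in> P; q \<in> P; leP q p\<rbrakk> \<Longrightarrow> leQ (\<pi> q) (\<pi> p)"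
    and proj: "\<And>p q. \<lbrakk>p \<in> P; q \<in> Q; leQ q (\<pi> p)\<rbrakk> \<Longrightarrow> \<exists>p'\<in>P. leP p' p \<and> leQ (\<pi> p') q"
    and dense: "\<And>q. q \<in> Q \<Longrightarrow> \<exists>p\<in>P. leQ (\<pi> p) q"
  shows "completely_embeds Q leQ P leP"
proof -
  let ?X = "poset_topology P leP" and ?Y = "poset_topology Q leQ"
  define h where "h U = {p \<in> P. \<pi> p \<in> U}" for U
  interpret X: preordered_set P leP by unfold_locales (use reflP transP in blast)+
  interpret Y: preordered_set Q leQ by unfold_locales (use reflQ transQ in blast)+
  note roQD = Y.ro_poset_topologyD
  have h_sup: "h (ro_sup ?Y \<V>) = ro_sup ?X (h ` \<V>)" if "\<V> \<subseteq> ro ?Y" for \<V>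
  proof -
    have V: "q' \<in> \<Union>\<V>" if q: "q \<in> \<Union>\<V>" "q' \<in> Q" "leQ q' q" for q q'
    proof -
      obtain U where U: "U \<in> \<V>" "q \<in> U" using q(1) by blast
      then have "U \<in> ro ?Y" using \<open>\<V> \<subseteq> ro ?Y\<close> by blast
      then show ?thesis using roQD(2)[OF _ U(2) q(2,3)] U(1) by blast
    qed
    have h: "r \<in> \<Union>(h ` \<V>) \<longleftrightarrow> r \<in> P \<and> \<pi> r \<in> \<Union>\<V>" for r
      unfolding h_def by blast
    \<comment> \<open>Both sides say that \<open>\<Union>\<V>\<close> is dense: on the left below
      \<open>\<pi> p\<close>, on the right, after pulling back, below \<open>p\<close>.\<close>
    have "(\<forall>q\<in>Q. leQ q (\<pi> p) \<longrightarrow> (\<exists>r\<in>Q. leQ r q \<and> r \<in> \<Union>\<V>)) \<longleftrightarrow>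
        (\<forall>q\<in>P. leP q p \<longrightarrow> (\<exists>r\<in>P. leP r q \<and> \<pi> r \<in> \<Union>\<V>))" (is "?l \<longleftrightarrow> ?r") if p: "p \<in> P" for p
    proof
      assume l: ?l
      show ?r
      proof (intro ballI impI)
        fix q assume q: "q \<in> P" "leP q p"
        then obtain r where r: "r \<in> Q" "leQ r (\<pi> q)" "r \<in> \<Union>\<V>"
          using l mono[OF p] \<pi> by blast
        then obtain p' where "p' \<in> P" "leP p' q" "leQ (\<pi> p') r"
          using proj q by blast
        then show "\<exists>r\<in>P. leP r q \<and> \<pi> r \<in> \<Union>\<V>" using V[OF r(3)] \<pi> by blast
      qed
    next
      assume r: ?r
      show ?l
      proof (intro ballI impI)
        fix q assume q: "q \<in> Q" "leQ q (\<pi> p)"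
        then obtain p' where p': "p' \<in> P" "leP p' p" "leQ (\<pi> p') q" using proj p by blast
        then obtain r' where "r' \<in> P" "leP r' p'" "\<pi> r' \<in> \<Union>\<V>" using r by blast
        then show "\<exists>r\<in>Q. leQ r q \<and> r \<in> \<Union>\<V>" using \<pi> mono[OF p'(1)] transQ[OF _ p'(3)] by blast
      qed
    qed
    then show ?thesis
      unfolding X.ro_sup_poset_topology Y.ro_sup_poset_topology
      unfolding h unfolding h_def using \<pi> by blast
  qed
  have h_compl: "h (ro_compl ?Y U) = ro_compl ?X (h U)" if U: "U \<in> ro ?Y" for U
  proof -
    have "(\<forall>q\<in>Q. leQ q (\<pi> p) \<longrightarrow> q \<notin> U) \<longleftrightarrow> (\<forall>q\<in>P. leP q p \<longrightarrow> \<pi> q \<notin> U)" if p: "p \<in> P" for p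
      using proj[OF p] mono[OF p] \<pi> roQD(2)[OF U] by blast
    then show ?thesis
      unfolding X.ro_compl_poset_topology Y.ro_compl_poset_topology
      unfolding h_def using \<pi> by blast
  qed
  have h_ro: "h U \<in> ro ?X" if U: "U \<in> ro ?Y" for U
  proof -
    have "\<pi> p \<in> U" if p: "p \<in> P" and d: "\<forall>q\<in>P. leP q p \<longrightarrow> (\<exists>r\<in>P. leP r q \<and> r \<in> h U)" for p
    proof (rule roQD(3)[OF U])
      show "\<pi> p \<in> Q" using \<pi> p .
      fix q assume q: "q \<in> Q" "leQ q (\<pi> p)"
      obtain p' where p': "p' \<in> P" "leP p' p" "leQ (\<pi> p') q" using proj p q by blast
      then obtain r where "r \<in> P" "leP r p'" "r \<in> h U" using d by blast
      then show "\<exists>r\<in>Q. leQ r q \<and> r \<in> U"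
        using \<pi> mono[OF p'(1)] transQ[OF _ p'(3)] unfolding h_def by blast
    qed
    moreover have "\<exists>r\<in>P. leP r q \<and> r \<in> h U" if "p \<in> P" "\<pi> p \<in> U" "q \<in> P" "leP q p" for p q
      using that mono roQD(2)[OF U that(2)] \<pi> reflP unfolding h_def by blast
    moreover have "p \<in> h U \<longleftrightarrow> p \<in> P \<and> \<pi> p \<in> U" for p
      unfolding h_def by blast
    ultimately show ?thesis
      unfolding X.in_ro_poset_topology by blast
  qed
  \<comment> \<open>Below any \<open>q'\<close> in \<open>U\<close> there is some
    \<open>\<pi> p\<close>; then \<open>p\<close> lies in \<open>h U = h V\<close>, so
    \<open>V\<close> is dense below every point of \<open>U\<close>.\<close>
  have sub: "U \<subseteq> V" if U: "U \<in> ro ?Y" and V: "V \<in> ro ?Y" and UV: "h U = h V" for U V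
  proof
    fix q assume q: "q \<in> U"
    show "q \<in> V"
    proof (rule roQD(3)[OF V])
      show "q \<in> Q" using q roQD(1)[OF U] by blast
      fix q' assume q': "q' \<in> Q" "leQ q' q"
      then have "q' \<in> U" using roQD(2)[OF U q] by blast
      obtain p where "p \<in> P" "leQ (\<pi> p) q'" using dense q' by blast
      then show "\<exists>r\<in>Q. leQ r q' \<and> r \<in> V"
        using roQD(2)[OF U \<open>q' \<in> U\<close>] \<pi> UV unfolding h_def by blast
    qed
  qed
  have inj: "inj_on h (ro ?Y)" using sub by (metis inj_onI subset_antisym)
  have "complete_subalgebra ?X (h ` ro ?Y)"
    unfolding complete_subalgebra_def
  proof (intro conjI allI impI ballI)
    show "h ` ro ?Y \<subseteq> ro ?X" using h_ro by blast
    show "ro_compl ?X U \<in> h ` ro ?Y" if "U \<in> h ` ro ?Y" for U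
      using that h_compl Y.ro_compl_in_ro by (elim imageE) (metis imageI)
    show "ro_sup ?X \<U> \<in> h ` ro ?Y" if \<U>: "\<U> \<subseteq> h ` ro ?Y" for \<U>
    proof -
      obtain \<V> where "\<V> \<subseteq> ro ?Y" "\<U> = h ` \<V>" using \<U> by (auto simp: subset_image_iff)
      then show ?thesis using h_sup Y.ro_sup_in_ro by (metis image_eqI subsetD)
    qed
  qed
  moreover have "ro_isomorphism ?Y ?X (h ` ro ?Y) h"
    unfolding ro_isomorphism_def
  proof (intro conjI ballI)
    show "bij_betw h (ro ?Y) (h ` ro ?Y)" using inj by (simp add: bij_betw_def)
    fix U V assume UV: "U \<in> ro ?Y" "V \<in> ro ?Y"
    show "h (U \<inter> V) = h U \<inter> h V" unfolding h_def by blast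
    show "h (ro_sup ?Y {U, V}) = ro_sup ?X {h U, h V}" using h_sup[of "{U, V}"] UV by simp
  qed (rule h_compl)
  ultimately show ?thesis unfolding completely_embeds_def by blast
qed

section \<open>Splitting the points of countable cofinality\<close>

text \<open>Stands for an uncountable regular cardinal. The order is a relation on a set and not a
  type class, as it will be the well-order of a least unbounded family of functions.
  \<open>segment_bounded\<close> is regularity.\<close>

locale uncountable_regular_order =
  fixes X :: "'i set" and lt :: "'i \<Rightarrow> 'i \<Rightarrow> bool"
  assumes lt_irrefl: "\<And>x. \<not> lt x x"
    and lt_trans: "\<And>x y z. lt x y \<Longrightarrow> lt y z \<Longrightarrow> lt x z"
    and lt_total: "\<And>x y. x \<in> X \<Longrightarrow> y \<in> X \<Longrightarrow> lt x y \<or> x = y \<or> lt y x"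
    and lt_least: "\<And>A. A \<subseteq> X \<Longrightarrow> A \<noteq> {} \<Longrightarrow> \<exists>m\<in>A. \<forall>a\<in>A. \<not> lt a m"
    and nonempty: "X \<noteq> {}"
    and countable_bounded: "\<And>A. A \<subseteq> X \<Longrightarrow> countable A \<Longrightarrow> \<exists>u\<in>X. \<forall>a\<in>A. lt a u"
    and segment_bounded:
      "\<And>z g. z \<in> X \<Longrightarrow> g \<in> X \<rightarrow> X \<Longrightarrow> \<exists>u\<in>X. \<forall>y\<in>X. lt y z \<longrightarrow> lt (g y) u"
begin

definition ladder_to :: "'i \<Rightarrow> (nat \<Rightarrow> 'i) \<Rightarrow> bool" where
  "ladder_to x z \<longleftrightarrow> (\<forall>k. z k \<in> X \<and> lt (z k) x \<and> lt (z k) (z (Suc k))) \<and>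
     (\<forall>y\<in>X. lt y x \<longrightarrow> (\<exists>k. lt y (z k)))"

text \<open>The points closed under some \<open>e\<close> play the part of a club, cut down to
  points of cofinality \<omega>. For sets of such points, stationarity amounts to meeting every one
  of these cuts.\<close>

definition closed_point :: "('i \<Rightarrow> 'i) \<Rightarrow> 'i \<Rightarrow> bool" where
  "closed_point e x \<longleftrightarrow> x \<in> X \<and> (\<exists>z. ladder_to x z) \<and> (\<forall>y\<in>X. lt y x \<longrightarrow> lt (e y) x)"

text \<open>Climb \<omega> steps from \<open>u\<close>, each step passing the values of
  \<open>e\<close> below the previous one. The supremum is closed under \<open>e\<close>, and the
  climb is its ladder.\<close>

lemma closed_point_exists:
  assumes e: "e \<in> X \<rightarrow> X" and u: "u \<in> X"
  shows "\<exists>x. closed_point e x \<and> lt u x"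
proof -
  have step: "\<exists>w\<in>X. lt v w \<and> (\<forall>y\<in>X. lt y v \<longrightarrow> lt (e y) w)" if v: "v \<in> X" for v
  proof -
    obtain w where w: "w \<in> X" "\<forall>y\<in>X. lt y v \<longrightarrow> lt (e y) w"
      using segment_bounded[OF v e] by blast
    obtain w' where "w' \<in> X" "lt v w'" "lt w w'"
      using countable_bounded[of "{v, w}"] v w by auto
    then show ?thesis using w lt_trans by blast
  qed
  have "\<exists>z. \<forall>n. (z n \<in> X \<and> (n = 0 \<longrightarrow> z n = u)) \<and>
      (lt (z n) (z (Suc n)) \<and> (\<forall>y\<in>X. lt y (z n) \<longrightarrow> lt (e y) (z (Suc n))))"
    by (rule dependent_nat_choice[where P = "\<lambda>n w. w \<in> X \<and> (n = 0 \<longrightarrow> w = u)"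
          and Q = "\<lambda>n v w. lt v w \<and> (\<forall>y\<in>X. lt y v \<longrightarrow> lt (e y) w)"])
      (use u step in auto)
  then obtain z where z: "\<And>n. z n \<in> X" "z 0 = u" "\<And>n. lt (z n) (z (Suc n))"
    "\<And>n y. y \<in> X \<Longrightarrow> lt y (z n) \<Longrightarrow> lt (e y) (z (Suc n))"
    by blast
  let ?A = "{w \<in> X. \<forall>n. lt (z n) w}"
  have "?A \<noteq> {}" using countable_bounded[of "range z"] z(1) by auto
  then obtain x where x: "x \<in> ?A" "\<forall>a\<in>?A. \<not> lt a x" using lt_least[of ?A] by blast
  have cof: "\<exists>k. lt y (z k)" if y: "y \<in> X" "lt y x" for y
  proof -
    have "y \<notin> ?A" using x(2) y by blast
    then obtain n where "\<not> lt (z n) y" using y by blast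
    then have "lt y (z n) \<or> y = z n" using lt_total z(1) y by blast
    then show ?thesis using z(3) by blast
  qed
  have zx: "lt (z k) x" for k using x(1) by blast
  have "ladder_to x z"
    unfolding ladder_to_def using z(1,3) zx cof by blast
  moreover have "lt (e y) x" if y: "y \<in> X" "lt y x" for y
    using cof[OF y] z(4)[OF y(1)] zx lt_trans by metis
  ultimately have "closed_point e x"
    unfolding closed_point_def using x(1) by blast
  then show ?thesis using x(1) z(2) by blast
qed

text \<open>
  A weak form of Solovay's splitting theorem for the stationary set of points of cofinality
  \<open>\<omega>\<close>: if no set \<open>{x. lad x n < g}\<close> split it, then for each \<open>n\<close> the map \<open>x \<mapsto> lad x n\<close> would be
  bounded on a club (it cannot exceed all \<open>g\<close> on a diagonal intersection), and so \<open>lad x\<close> would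
  not be cofinal in \<open>x\<close>.
\<close>

lemma split_closed_points:
  "\<exists>S. \<forall>e\<in>X \<rightarrow> X. \<forall>v. \<exists>x. closed_point e x \<and> (x \<in> S \<longleftrightarrow> v)"
proof (rule ccontr)
  assume neg: "\<not> ?thesis"
  define lad where "lad x = (SOME z. ladder_to x z)" for x
  have lad: "ladder_to x (lad x)" if "closed_point e x" for e x
    using that unfolding lad_def closed_point_def by (metis someI_ex)
  \<comment> \<open>As \<open>{x. lt (lad x n) g}\<close> does not split, the truth value of
    \<open>lt (lad x n) g\<close> is constant on the points closed under some \<open>e\<close>;
    \<open>V n g\<close> will be that value.\<close>
  have "\<exists>e\<in>X \<rightarrow> X. \<exists>v. \<forall>x. closed_point e x \<longrightarrow> (lt (lad x n) g \<longleftrightarrow> v)" for n g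
  proof -
    obtain e v where "e \<in> X \<rightarrow> X" "\<forall>x. closed_point e x \<longrightarrow> lt (lad x n) g \<noteq> v"
      using neg by (auto dest!: spec[of _ "{x. lt (lad x n) g}"])
    then show ?thesis by (intro bexI[of _ e] exI[of _ "\<not> v"]) auto
  qed
  then obtain E V where E: "\<And>n g. E n g \<in> X \<rightarrow> X"
    and V: "\<And>n g x. closed_point (E n g) x \<Longrightarrow> lt (lad x n) g \<longleftrightarrow> V n g"
    by metis
  have anti: "closed_point e x"
    if "closed_point e' x" "\<And>y. y \<in> X \<Longrightarrow> lt y x \<Longrightarrow> lt (e y) x" for e e' x
    using that unfolding closed_point_def by blast
  have "\<exists>g\<in>X. V n g" for n
  proof (rule ccontr)
    assume "\<not> (\<exists>g\<in>X. V n g)"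
    then have V': "closed_point (E n g) x \<Longrightarrow> g \<in> X \<Longrightarrow> \<not> lt (lad x n) g" for g x using V by blast
    \<comment> \<open>Diagonal intersection: a point closed under the \<open>e\<close> obtained from
      these bounds is closed under \<open>E n g\<close> for every \<open>g\<close> below it.\<close>
    have "\<exists>u\<in>X. \<forall>g\<in>X. lt g z \<longrightarrow> (\<forall>y\<in>X. lt y z \<longrightarrow> lt (E n g y) u)" if z: "z \<in> X" for z
    proof -
      have "\<forall>g. \<exists>u\<in>X. \<forall>y\<in>X. lt y z \<longrightarrow> lt (E n g y) u"
        using segment_bounded[OF z E] by blast
      then obtain U where U: "\<And>g. U g \<in> X" "\<And>g y. y \<in> X \<Longrightarrow> lt y z \<Longrightarrow> lt (E n g y) (U g)"
        by metis
      then obtain u where "u \<in> X" "\<forall>g\<in>X. lt g z \<longrightarrow> lt (U g) u"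
        using segment_bounded[OF z, of U] by blast
      then show ?thesis using U lt_trans by blast
    qed
    then obtain e where e: "\<And>z. z \<in> X \<Longrightarrow> e z \<in> X"
      "\<And>z g y. \<lbrakk>z \<in> X; g \<in> X; lt g z; y \<in> X; lt y z\<rbrakk> \<Longrightarrow> lt (E n g y) (e z)"
      by metis
    obtain x where x: "closed_point e x" using closed_point_exists[of e] e(1) nonempty by blast
    note l = lad[OF x, unfolded ladder_to_def]
    \<comment> \<open>This \<open>g\<close> is below \<open>x\<close> and yet above
      \<open>lad x n\<close>, which will contradict \<open>V'\<close>.\<close>
    let ?g = "lad x (Suc n)"
    have "lt (E n ?g y) x" if y: "y \<in> X" "lt y x" for y
    proof -
      obtain k where k: "lt y (lad x k)" using l y by blast
      have "\<exists>z\<in>X. lt z x \<and> lt ?g z \<and> lt y z"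
      proof (cases "lt y ?g")
        case True
        then show ?thesis using l lt_trans by (meson)
      next
        case False
        then have "lt ?g y \<or> ?g = y" using lt_total l y by blast
        then show ?thesis using k l lt_trans by blast
      qed
      then obtain z where z: "z \<in> X" "lt z x" "lt ?g z" "lt y z" by blast
      then have "lt (E n ?g y) (e z)" using e(2) l y by blast
      moreover have "lt (e z) x" using x z unfolding closed_point_def by blast
      ultimately show ?thesis using lt_trans by blast
    qed
    then have "closed_point (E n ?g) x" using anti[OF x] by blast
    then show False using V' l by blast
  qed
  then obtain G where G: "\<And>n. G n \<in> X" "\<And>n. V n (G n)" by metis
  \<comment> \<open>With one \<open>g\<close> above all \<open>G n\<close> and one \<open>e\<close>
    beating all \<open>E n (G n)\<close>, a point above \<open>g\<close> that is closed under
    \<open>e\<close> has its whole ladder below \<open>g\<close>.\<close>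
  obtain g where g: "g \<in> X" "\<And>n. lt (G n) g" using countable_bounded[of "range G"] G(1) by auto
  have "\<exists>u\<in>X. \<forall>n. lt (E n (G n) y) u" if "y \<in> X" for y
    using countable_bounded[of "range (\<lambda>n. E n (G n) y)"] E that by fastforce
  then obtain e where e: "\<And>y. y \<in> X \<Longrightarrow> e y \<in> X" "\<And>y n. y \<in> X \<Longrightarrow> lt (E n (G n) y) (e y)"
    by metis
  obtain x where x: "closed_point e x" "lt g x"
    using closed_point_exists[of e g] e(1) g by blast
  have "closed_point (E n (G n)) x" for n
    using anti[OF x(1)] x(1) e(2) lt_trans unfolding closed_point_def by blast
  then have "lt (lad x n) (G n)" for n using V G by blast
  then have "lt (lad x n) g" for n using g lt_trans by blast
  moreover obtain k where "lt g (lad x k)"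
    using lad[OF x(1)] x(2) g(1) unfolding ladder_to_def by blast
  ultimately show False using lt_trans lt_irrefl by blast
qed

end

section \<open>A colouring of a product of regular cardinals\<close>

text \<open>Histories are listed with the most recent value first.\<close>

primrec histories :: "(nat \<Rightarrow> 'a::ord) \<Rightarrow> nat \<Rightarrow> 'a list set" where
  "histories mu 0 = {[]}"
| "histories mu (Suc n) = {b # xs | b xs. b < mu n \<and> xs \<in> histories mu n}"

lemma length_histories: "xs \<in> histories mu n \<Longrightarrow> length xs = n"
  by (induction n arbitrary: xs) auto

primrec history :: "(nat \<Rightarrow> 'a) \<Rightarrow> nat \<Rightarrow> 'a list" where
  "history f 0 = []"
| "history f (Suc n) = f n # history f n"

text \<open>Course-of-values recursion: \<open>L n\<close> collects the values chosen so far and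
  turns out to be the history of the resulting \<open>f\<close>.\<close>

lemma history_branch:
  obtains f where "\<And>n. f n = pick (history f n)"
proof -
  define L where "L n = rec_nat [] (\<lambda>_ xs. pick xs # xs) n" for n :: nat
  define f where "f n = pick (L n)" for n
  have "history f n = L n" for n
    by (induction n) (auto simp: L_def f_def)
  then show thesis using that[of f] by (simp add: f_def)
qed

text \<open>\<open>S\<close> describes a tree by the values that may follow each history. Before
  stage \<open>m\<close> the successor sets may be single points, as happens along a node fixed in
  advance; from stage \<open>m\<close> on they are unbounded. The colouring takes both values on the
  branches of every such tree.\<close>

definition bichromatic :: "(nat \<Rightarrow> 'a::ord) \<Rightarrow> ((nat \<Rightarrow> 'a) \<Rightarrow> bool) \<Rightarrow> bool" where
  "bichromatic mu c \<longleftrightarrow> (\<forall>S m v.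
     (\<forall>n. \<forall>xs\<in>histories mu n. S xs \<noteq> {} \<and> S xs \<subseteq> {..<mu n}) \<longrightarrow>
     (\<forall>n\<ge>m. \<forall>xs\<in>histories mu n. \<forall>b<mu n. \<exists>c\<in>S xs. b \<le> c) \<longrightarrow>
     (\<exists>f. (\<forall>n. f n \<in> S (history f n)) \<and> c f = v))"

text \<open>\<open>regular\<close> packs together two facts about increasing regular cardinals:
  \<open>mu i < mu n\<close> for \<open>i < n\<close>, and regularity of
  \<open>mu n\<close>.\<close>

locale product_of_regulars =
  fixes mu :: "nat \<Rightarrow> 'a::wellorder"
  assumes inhabited: "\<And>n. \<exists>b. b < mu n"
    and no_max: "\<And>n b. b < mu n \<Longrightarrow> \<exists>c<mu n. b < c"
    and regular: "\<And>i n g. i < n \<Longrightarrow> (\<And>b. b < mu i \<Longrightarrow> g b < mu n) \<Longrightarrow> \<exists>u<mu n. \<forall>b<mu i. g b \<le> u"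
begin

definition prods :: "(nat \<Rightarrow> 'a) set" where
  "prods = {f. \<forall>n. f n < mu n}"

section \<open>Eventual domination in the product\<close>

definition dominated :: "(nat \<Rightarrow> 'a) \<Rightarrow> (nat \<Rightarrow> 'a) \<Rightarrow> bool" where
  "dominated f g \<longleftrightarrow> (\<exists>m. \<forall>n\<ge>m. f n \<le> g n)"

lemma dominated_refl: "dominated f f"
  unfolding dominated_def by blast

lemma dominated_trans:
  assumes "dominated f g" "dominated g h"
  shows "dominated f h"
proof -
  obtain m m' where "\<forall>n\<ge>m. f n \<le> g n" "\<forall>n\<ge>m'. g n \<le> h n"
    using assms unfolding dominated_def by blast
  then have "\<forall>n\<ge>max m m'. f n \<le> h n" by (meson max.boundedE order_trans)
  then show ?thesis unfolding dominated_def by blast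
qed

text \<open>Bound the histories with most recent value \<open>b\<close> by \<open>U b\<close>,
  inductively, and then \<open>U\<close> on \<open>mu j\<close> by \<open>regular\<close>. A history
  of length \<open>n\<close> only has values below \<open>mu i\<close> with \<open>i < n\<close>, so
  \<open>j = n\<close> is allowed.\<close>

lemma bounded_on_histories:
  assumes "j \<le> n" "\<And>xs. xs \<in> histories mu j \<Longrightarrow> G xs < mu n"
  shows "\<exists>u<mu n. \<forall>xs\<in>histories mu j. G xs \<le> u"
  using assms
proof (induction j arbitrary: G)
  case 0
  then show ?case by (intro exI[of _ "G []"]) auto
next
  case (Suc j)
  have "\<exists>u<mu n. \<forall>xs\<in>histories mu j. G (b # xs) \<le> u" if "b < mu j" for b
    using Suc.IH[of "\<lambda>xs. G (b # xs)"] Suc.prems that by auto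
  then obtain U where U: "\<And>b. b < mu j \<Longrightarrow> U b < mu n"
    "\<And>b xs. b < mu j \<Longrightarrow> xs \<in> histories mu j \<Longrightarrow> G (b # xs) \<le> U b"
    by metis
  obtain u where "u < mu n" "\<forall>b<mu j. U b \<le> u" using regular[of j n U] U(1) Suc.prems by auto
  then show ?case using U(2) by (intro exI[of _ u]) (auto intro: order_trans)
qed

text \<open>Diagonal maximum: at \<open>n\<close>, take the largest of the values at
  \<open>n\<close> of the first \<open>n + 1\<close> functions.\<close>

lemma countable_dominated:
  assumes A: "A \<subseteq> prods" "countable A"
  shows "\<exists>y\<in>prods. \<forall>x\<in>A. dominated x y"
proof (cases "A = {}")
  case True
  obtain y where "\<And>n. y n < mu n" using inhabited by metis
  then show ?thesis using True unfolding prods_def by auto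
next
  case False
  define a where "a = from_nat_into A"
  have a: "range a = A" unfolding a_def using A False by simp
  define y where "y n = Max ((\<lambda>i. a i n) ` {..n})" for n
  have "y n \<in> (\<lambda>i. a i n) ` {..n}" for n unfolding y_def by (rule Max_in) auto
  moreover have "a i \<in> prods" for i using a A by blast
  ultimately have "y n < mu n" for n unfolding prods_def by (smt (verit) imageE mem_Collect_eq)
  then have "y \<in> prods" unfolding prods_def by blast
  moreover have "dominated (a i) y" for i
    unfolding dominated_def y_def by (intro exI[of _ i] allI impI Max_ge) auto
  then have "\<forall>x\<in>A. dominated x y" using a by blast
  ultimately show ?thesis by blast
qed

lemma prods_not_dominated:
  assumes "y \<in> prods"
  shows "\<exists>x\<in>prods. \<not> dominated x y"
proof -
  have "\<forall>n. \<exists>c<mu n. y n < c" using assms no_max unfolding prods_def by blast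
  then obtain x where "\<And>n. x n < mu n" "\<And>n. y n < x n" by metis
  then show ?thesis unfolding prods_def dominated_def by (auto intro!: exI[of _ x] simp: not_le)
qed

text \<open>Let \<open>X\<close> be an unbounded family of least size, well-ordered in the type of
  its cardinality. Fewer than \<open>|X|\<close> functions always have a common bound modulo finite,
  so \<open>h x\<close> can be chosen by recursion above all earlier \<open>h y\<close>. Since no
  single function dominates the whole chain, the order is regular and uncountable.\<close>

lemma unbounded_chain:
  "\<exists>(X :: (nat \<Rightarrow> 'a) set) lt h. uncountable_regular_order X lt \<and> (\<forall>x\<in>X. h x \<in> prods) \<and>
     (\<forall>x\<in>X. \<forall>y\<in>X. lt x y \<longrightarrow> dominated (h x) (h y)) \<and>
     (\<forall>f\<in>prods. \<exists>x\<in>X. \<not> dominated (h x) f)"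
proof -
  define unb where "unb A \<longleftrightarrow> A \<subseteq> prods \<and> (\<forall>y\<in>prods. \<exists>x\<in>A. \<not> dominated x y)" for A
  have "unb prods" unfolding unb_def using prods_not_dominated by blast
  then have "\<exists>r\<in>{ |A| | A. unb A}. \<forall>r'\<in>{ |A| | A. unb A}. r \<le>o r'"
    by (intro exists_minim_Card_order) (auto simp: card_of_Card_order)
  then obtain X where X: "unb X" and min: "\<And>A. unb A \<Longrightarrow> |X| \<le>o |A|"
    by blast
  define r where "r = |X|"
  have r: "Card_order r" "Well_order r" "Field r = X"
    unfolding r_def by (rule card_of_Card_order, rule card_of_Well_order, rule Field_card_of)
  have wf: "wf (r - Id)" using r(2) by (simp add: well_order_on_def)
  define lt where "lt x y \<longleftrightarrow> (x, y) \<in> r \<and> x \<noteq> y" for x y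
  have small: "\<exists>y\<in>prods. \<forall>x\<in>A. dominated x y" if "A \<subseteq> prods" "|A| <o |X|" for A
    using min[of A] that not_ordLess_ordLeq unfolding unb_def by blast
  have infX: "infinite X"
    using X countable_dominated[of X] countable_finite unfolding unb_def by blast
  define B where "B A = (SOME y. y \<in> prods \<and> (\<forall>x\<in>A. dominated x y))" for A
  have B: "B A \<in> prods" "x \<in> A \<Longrightarrow> dominated x (B A)" if "A \<subseteq> prods" "|A| <o |X|" for A x
    using someI_ex[of "\<lambda>y. y \<in> prods \<and> (\<forall>x\<in>A. dominated x y)"] small[OF that]
    unfolding B_def by blast+
  \<comment> \<open>Adding \<open>x\<close> itself to the earlier values makes the chain inherit
    unboundedness from \<open>X\<close>.\<close>
  define H where "H = (\<lambda>g x. B (insert x (g ` underS r x)))"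
  define h where "h = wfrec (r - Id) H"
  have h_eq: "h x = B (insert x (h ` underS r x))" for x
  proof -
    have "h x = H (cut h (r - Id) x) x" unfolding h_def by (rule wfrec[OF wf])
    moreover have "cut h (r - Id) x ` underS r x = h ` underS r x"
      by (rule image_cong) (auto simp: cut_def underS_def)
    ultimately show ?thesis unfolding H_def by simp
  qed
  have underS: "|underS r x| <o |X|" if "x \<in> X" for x
    using card_of_underS[OF r(1)] that r(3) unfolding r_def by simp
  have card: "|insert x (h ` underS r x)| <o |X|" if "x \<in> X" for x
  proof -
    have "|h ` underS r x| <o |X|"
      using card_of_image underS[OF that] by (rule ordLeq_ordLess_trans)
    moreover have "|{x}| <o |X|" 
      using infX by (intro finite_ordLess_infinite) (auto simp: Field_card_of card_of_well_order_on)
    ultimately have "|{x} \<union> h ` underS r x| <o |X|"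
      using card_of_Un_ordLess_infinite[OF infX] by blast
    then show ?thesis by simp
  qed
  have X_prods: "X \<subseteq> prods" using X unfolding unb_def by blast
  have h_prods: "x \<in> X \<longrightarrow> h x \<in> prods" for x
  proof (induction x rule: wf_induct_rule[OF wf])
    case (1 x)
    show ?case
    proof
      assume x: "x \<in> X"
      have "h ` underS r x \<subseteq> prods"
        using 1 r(3) unfolding underS_def by (auto simp: Field_def)
      then show "h x \<in> prods"
        using B(1)[OF _ card[OF x]] X_prods x unfolding h_eq[of x] by blast
    qed
  qed
  have sub: "insert x (h ` underS r x) \<subseteq> prods" if "x \<in> X" for x
    using h_prods X_prods that r(3) unfolding underS_def by (auto simp: Field_def)
  have h_above: "dominated x (h x)" if "x \<in> X" for x
    unfolding h_eq[of x] using B(2)[OF sub card] that by blast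
  have h_mono: "dominated (h y) (h x)" if "x \<in> X" "lt y x" for x y
    unfolding h_eq[of x] using B(2)[OF sub card] that unfolding lt_def underS_def by blast
  have h_unb: "\<exists>x\<in>X. \<not> dominated (h x) f" if "f \<in> prods" for f
    using X that dominated_trans[OF h_above, of _ f] unfolding unb_def by blast
  have total: "lt x y \<or> x = y \<or> lt y x" if "x \<in> X" "y \<in> X" for x y
    using r(2,3) that unfolding lt_def well_order_on_def linear_order_on_def total_on_def by blast
  \<comment> \<open>If the indices in \<open>A\<close> were unbounded, the chain being increasing, a
    common bound \<open>y\<close> of their values would dominate every \<open>h u\<close>. Both
    boundedness axioms of the locale follow from this.\<close>
  have bounded: "\<exists>u\<in>X. \<forall>a\<in>A. lt a u"
    if A: "A \<subseteq> X" and y: "y \<in> prods" "\<forall>a\<in>A. dominated (h a) y" for A y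
  proof (rule ccontr)
    assume neg: "\<not> ?thesis"
    have "dominated (h u) y" if u: "u \<in> X" for u
    proof -
      obtain a where a: "a \<in> A" "\<not> lt a u" using neg u by blast
      then have "a = u \<or> lt u a" using total[of a u] A u by blast
      moreover have "a \<in> X" "dominated (h a) y" using a A y by blast+
      ultimately show ?thesis using dominated_trans[OF h_mono] by blast
    qed
    then show False using h_unb[OF y(1)] by blast
  qed
  have "uncountable_regular_order X lt"
  proof
    show "\<not> lt x x" for x unfolding lt_def by blast
    show "lt x z" if "lt x y" "lt y z" for x y z
    proof -
      have "trans r" "antisym r" using r(2) unfolding well_order_on_def order_on_defs by blast+
      then show ?thesis using that unfolding lt_def by (metis antisymD transD)
    qed
    show "lt x y \<or> x = y \<or> lt y x" if "x \<in> X" "y \<in> X" for x y using total that .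
    show "\<exists>m\<in>A. \<forall>a\<in>A. \<not> lt a m" if "A \<subseteq> X" "A \<noteq> {}" for A
      using wfE_min'[OF wf that(2)] unfolding lt_def by (metis DiffI pair_in_Id_conv)
    show "X \<noteq> {}" using infX by auto
    show "\<exists>u\<in>X. \<forall>a\<in>A. lt a u" if A: "A \<subseteq> X" "countable A" for A
    proof -
      have "\<exists>y\<in>prods. \<forall>x\<in>h ` A. dominated x y"
        using countable_dominated[of "h ` A"] h_prods A by blast
      then show ?thesis using bounded[OF A(1)] by blast
    qed
    show "\<exists>u\<in>X. \<forall>y\<in>X. lt y z \<longrightarrow> lt (g y) u" if z: "z \<in> X" and g: "g \<in> X \<rightarrow> X" for z g
    proof -
      let ?A = "g ` underS r z"
      have A: "?A \<subseteq> X" using g r(3) unfolding underS_def by (auto simp: Field_def)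
      have "|h ` ?A| <o |X|"
        by (metis card_of_image image_comp ordLeq_ordLess_trans underS[OF z])
      then obtain y where "y \<in> prods" "\<forall>x\<in>h ` ?A. dominated x y"
        using small[of "h ` ?A"] h_prods A by blast
      then obtain u where u: "u \<in> X" "\<forall>a\<in>?A. lt a u" using bounded[OF A, of y] by auto
      have "lt (g y) u" if "lt y z" for y
        using u(2) that unfolding lt_def[of y z] underS_def by blast
      then show ?thesis using u(1) by blast
    qed
  qed
  then show ?thesis
    using h_prods h_mono h_unb by (intro exI[of _ X] exI[of _ lt] exI[of _ h]) auto
qed

text \<open>
  The colour of \<open>f\<close> is read off the least \<open>x\<close> such that \<open>f\<close> fails to dominate the \<open>x\<close>-th
  element of an unbounded chain modulo finite. Every tree with large successor sets has branches
  for which this is any prescribed \<open>x\<close> of cofinality \<open>\<omega>\<close> in a suitable club.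
\<close>

lemma bichromatic_exists: "\<exists>c. bichromatic mu c"
proof -
  obtain X :: "(nat \<Rightarrow> 'a) set" and lt h where X: "uncountable_regular_order X lt"
    and props: "\<forall>x\<in>X. h x \<in> prods" "\<forall>x\<in>X. \<forall>y\<in>X. lt x y \<longrightarrow> dominated (h x) (h y)"
      "\<forall>f\<in>prods. \<exists>x\<in>X. \<not> dominated (h x) f"
    using unbounded_chain by blast
  have h: "h x \<in> prods" if "x \<in> X" for x using props(1) that by blast
  have mono: "dominated (h x) (h y)" if "x \<in> X" "y \<in> X" "lt x y" for x y
    using props(2) that by blast
  have unb: "\<exists>x\<in>X. \<not> dominated (h x) f" if "f \<in> prods" for f using props(3) that by blast
  interpret X: uncountable_regular_order X lt by (rule X)
  obtain R where R: "\<And>e v. e \<in> X \<rightarrow> X \<Longrightarrow> \<exists>x. X.closed_point e x \<and> (x \<in> R \<longleftrightarrow> v)"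
    using X.split_closed_points by blast
  define owner where
    "owner f x \<longleftrightarrow> x \<in> X \<and> \<not> dominated (h x) f \<and> (\<forall>y\<in>X. lt y x \<longrightarrow> dominated (h y) f)" for f x
  have owner_unique: "x = y" if "owner f x" "owner f y" for f x y
    using that X.lt_total unfolding owner_def by blast
  define c where "c f \<longleftrightarrow> (\<exists>x\<in>R. owner f x)" for f
  have branch: "\<exists>f. (\<forall>n. f n \<in> S (history f n)) \<and> c f = v"
    if S: "\<And>n xs. xs \<in> histories mu n \<Longrightarrow> S xs \<noteq> {} \<and> S xs \<subseteq> {..<mu n}"
      and large: "\<And>n xs b. \<lbrakk>m \<le> n; xs \<in> histories mu n; b < mu n\<rbrakk> \<Longrightarrow> \<exists>c\<in>S xs. b \<le> c"
    for S m v
  proof -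
    \<comment> \<open>From stage \<open>m\<close> on there is room for a successor between
      \<open>g n\<close> and \<open>d n\<close> after every history; a single \<open>d n\<close>
      serves all histories by \<open>bounded_on_histories\<close>.\<close>
    have "\<exists>d\<in>prods. \<forall>n\<ge>m. \<forall>xs\<in>histories mu n. \<exists>b\<in>S xs. g n \<le> b \<and> b < d n"
      if g: "g \<in> prods" for g
    proof -
      have "\<exists>d<mu n. n \<ge> m \<longrightarrow> (\<forall>xs\<in>histories mu n. \<exists>b\<in>S xs. g n \<le> b \<and> b < d)" for n
      proof (cases "n \<ge> m")
        case True
        have "\<forall>xs\<in>histories mu n. \<exists>b\<in>S xs. g n \<le> b"
          using large True g unfolding prods_def by blast
        then obtain G where G: "\<And>xs. xs \<in> histories mu n \<Longrightarrow> G xs \<in> S xs \<and> g n \<le> G xs" by metis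
        then have "\<And>xs. xs \<in> histories mu n \<Longrightarrow> G xs < mu n" using S by blast
        then obtain u where u: "u < mu n" "\<forall>xs\<in>histories mu n. G xs \<le> u"
          using bounded_on_histories[of n n G] by blast
        obtain d where "d < mu n" "u < d" using no_max u by blast
        then show ?thesis using G u by (meson le_less_trans)
      next
        case False
        then show ?thesis using inhabited by blast
      qed
      then obtain d where "\<And>n. d n < mu n"
        "\<And>n. n \<ge> m \<Longrightarrow> \<forall>xs\<in>histories mu n. \<exists>b\<in>S xs. g n \<le> b \<and> b < d n"
        by metis
      then show ?thesis unfolding prods_def by blast
    qed
    then obtain d where d: "\<And>g. g \<in> prods \<Longrightarrow> d g \<in> prods"
      "\<And>g n xs. \<lbrakk>g \<in> prods; n \<ge> m; xs \<in> histories mu n\<rbrakk> \<Longrightarrow> \<exists>b\<in>S xs. g n \<le> b \<and> b < d g n"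
      by metis
    \<comment> \<open>The value of \<open>h\<close> at \<open>e x\<close> escapes
      \<open>d (h x)\<close>. Hence, at a point \<open>x\<close> closed under \<open>e\<close>,
      \<open>h x\<close> escapes \<open>d (h (z k))\<close> for every rung \<open>z k\<close> of
      \<open>x\<close>.\<close>
    have "\<forall>x\<in>X. \<exists>y\<in>X. \<not> dominated (h y) (d (h x))" using unb d(1) h by blast
    then obtain e where e: "\<And>x. x \<in> X \<Longrightarrow> e x \<in> X" "\<And>x. x \<in> X \<Longrightarrow> \<not> dominated (h (e x)) (d (h x))"
      by metis
    obtain x where x: "X.closed_point e x" "x \<in> R \<longleftrightarrow> v" using R[of e v] e(1) by blast
    have xX: "x \<in> X" using x unfolding X.closed_point_def by blast
    obtain z where "X.ladder_to x z" using x unfolding X.closed_point_def by blast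
    then have z: "\<And>k. z k \<in> X" "\<And>k. lt (z k) x" "\<And>k. lt (z k) (z (Suc k))"
      "\<And>y. y \<in> X \<Longrightarrow> lt y x \<Longrightarrow> \<exists>k. lt y (z k)"
      unfolding X.ladder_to_def by blast+
    have z_mono: "dominated (h (z i)) (h (z k))" if "i \<le> k" for i k
      using that
    proof (induction rule: dec_induct)
      case base
      then show ?case by (rule dominated_refl)
    next
      case (step n)
      then show ?case using mono z dominated_trans by blast
    qed
    have inf: "\<exists>n>M. d (h (z k)) n < h x n" for k M
    proof -
      have "\<not> dominated (h x) (d (h (z k)))"
        using e(1,2)[OF z(1)] x z(1,2) mono[OF _ xX] dominated_trans
        unfolding X.closed_point_def by blast
      then show ?thesis unfolding dominated_def by (meson Suc_le_lessD not_le)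
    qed
    have late: "\<exists>M. \<forall>n\<ge>M. \<forall>i\<le>k. h (z i) n \<le> h (z k) n" for k
    proof -
      have "\<forall>i. \<exists>M. i \<le> k \<longrightarrow> (\<forall>n\<ge>M. h (z i) n \<le> h (z k) n)"
        using z_mono[of _ k] unfolding dominated_def by blast
      then obtain M where M: "\<And>i. i \<le> k \<Longrightarrow> \<forall>n\<ge>M i. h (z i) n \<le> h (z k) n"
        by metis
      have "M i \<le> Max (M ` {..k})" if "i \<le> k" for i using that by simp
      then show ?thesis using M by (meson order_trans)
    qed
    \<comment> \<open>At stage \<open>N k\<close> the function \<open>h x\<close> exceeds
      \<open>d (h (z k))\<close>, and from that stage on \<open>h (z k)\<close> majorizes the
      earlier \<open>h (z i)\<close>.\<close>
    have "\<exists>N. \<forall>k. (N k \<ge> m \<and> d (h (z k)) (N k) < h x (N k) \<and>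
        (\<forall>n\<ge>N k. \<forall>i\<le>k. h (z i) n \<le> h (z k) n)) \<and> N k < N (Suc k)"
    proof (rule dependent_nat_choice)
      have nxt: "\<exists>n. (n \<ge> m \<and> d (h (z k)) n < h x n \<and>
          (\<forall>n'\<ge>n. \<forall>i\<le>k. h (z i) n' \<le> h (z k) n')) \<and> l < n" for k l
      proof -
        obtain M where M: "\<forall>n\<ge>M. \<forall>i\<le>k. h (z i) n \<le> h (z k) n" using late by blast
        obtain n where "n > max (max l m) M" "d (h (z k)) n < h x n" using inf by blast
        then show ?thesis using M by (intro exI[of _ n]) auto
      qed
      show "\<exists>n. n \<ge> m \<and> d (h (z 0)) n < h x n \<and> (\<forall>n'\<ge>n. \<forall>i\<le>0. h (z i) n' \<le> h (z 0) n')"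
        using nxt[of 0 0] by blast
      show "\<exists>n. (n \<ge> m \<and> d (h (z (Suc k))) n < h x n \<and>
          (\<forall>n'\<ge>n. \<forall>i\<le>Suc k. h (z i) n' \<le> h (z (Suc k)) n')) \<and> l < n" for l k
        using nxt .
    qed
    then obtain N where N: "\<And>k. N k \<ge> m" "\<And>k. d (h (z k)) (N k) < h x (N k)"
      "\<And>k n i. \<lbrakk>N k \<le> n; i \<le> k\<rbrakk> \<Longrightarrow> h (z i) n \<le> h (z k) n" "\<And>k. N k < N (Suc k)"
      by metis
    have N_mono: "strict_mono N" using N(4) by (simp add: strict_mono_Suc_iff)
    \<comment> \<open>The last index whose stage has been reached by \<open>n\<close>; meaningful
      once \<open>N 0 \<le> n\<close>.\<close>
    define K where "K n = Max {k. N k \<le> n}" for n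
    have fin: "finite {k. N k \<le> n}" for n
      by (rule finite_subset[of _ "{..n}"])
        (use strict_mono_imp_increasing[OF N_mono] in \<open>auto intro: order_trans\<close>)
    have K1: "N (K n) \<le> n" if "N 0 \<le> n" for n
      using Max_in[OF fin[of n]] that unfolding K_def by blast
    have K2: "i \<le> K n" if "N i \<le> n" for i n
      using Max_ge[OF fin[of n]] that unfolding K_def by blast
    have K3: "K (N k) = k" for k
      using K1[of "N k"] K2[of k "N k"] N_mono
      by (metis le_antisym le0 order_refl strict_mono_less_eq)
    \<comment> \<open>At stage \<open>n\<close> the branch stays at or above
      \<open>h (z (K n))\<close> but below \<open>d (h (z (K n)))\<close>. The first makes it
      dominate every \<open>h (z i)\<close>, the second puts it below \<open>h x\<close> at each
      stage \<open>N k\<close>; so \<open>x\<close> owns it.\<close>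
    define pick where "pick xs = (SOME b. b \<in> S xs \<and> (N 0 \<le> length xs \<longrightarrow>
        h (z (K (length xs))) (length xs) \<le> b \<and> b < d (h (z (K (length xs)))) (length xs)))" for xs
    have pick: "pick xs \<in> S xs" "N 0 \<le> n \<Longrightarrow> h (z (K n)) n \<le> pick xs \<and> pick xs < d (h (z (K n))) n"
      if xs: "xs \<in> histories mu n" for xs n
    proof -
      have "\<exists>b. b \<in> S xs \<and> (N 0 \<le> length xs \<longrightarrow>
          h (z (K (length xs))) (length xs) \<le> b \<and> b < d (h (z (K (length xs)))) (length xs))"
      proof (cases "N 0 \<le> n")
        case True
        then have "n \<ge> m" using N(1) order_trans by blast
        then show ?thesis using d(2)[OF h[OF z(1)] _ xs] length_histories[OF xs] by blast
      next
        case False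
        then show ?thesis using S[OF xs] length_histories[OF xs] by blast
      qed
      from someI_ex[OF this] show "pick xs \<in> S xs"
        "N 0 \<le> n \<Longrightarrow> h (z (K n)) n \<le> pick xs \<and> pick xs < d (h (z (K n))) n"
        unfolding pick_def[symmetric] using length_histories[OF xs] by auto
    qed
    obtain f where f: "\<And>n. f n = pick (history f n)" using history_branch by blast
    have hist: "history f n \<in> histories mu n" for n
    proof (induction n)
      case (Suc n)
      then have "f n < mu n" using f[of n] pick(1)[OF Suc] S[OF Suc] by auto
      then show ?case using Suc by simp
    qed simp
    have fS: "f n \<in> S (history f n)" for n using f[of n] pick(1)[OF hist] by simp
    have f_bd: "h (z (K n)) n \<le> f n \<and> f n < d (h (z (K n))) n" if "N 0 \<le> n" for n
      using f[of n] pick(2)[OF hist that] by simp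
    have dom: "dominated (h (z i)) f" for i
    proof -
      have "h (z i) n \<le> f n" if "N i \<le> n" for n
      proof -
        have N0: "N 0 \<le> n" using N_mono that by (metis le0 order_trans strict_mono_less_eq)
        show ?thesis using N(3)[OF K1[OF N0] K2[OF that]] f_bd[OF N0] by (meson order_trans)
      qed
      then show ?thesis unfolding dominated_def by blast
    qed
    have "\<not> dominated (h x) f"
    proof
      assume "dominated (h x) f"
      then obtain M where M: "\<forall>n\<ge>M. h x n \<le> f n" unfolding dominated_def by blast
      have "M \<le> N M" using strict_mono_imp_increasing[OF N_mono] .
      then have "h x (N M) \<le> f (N M)" using M by blast
      moreover have "N 0 \<le> N M" using N_mono by (simp add: strict_mono_less_eq)
      then have "f (N M) < d (h (z M)) (N M)" using f_bd[of "N M"] K3 by simp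
      ultimately show False using N(2)[of M] by simp
    qed
    moreover have "dominated (h y) f" if y: "y \<in> X" "lt y x" for y
    proof -
      obtain k where "lt y (z k)" using z(4) y by blast
      then show ?thesis using dominated_trans[OF mono[OF y(1) z(1)] dom] by blast
    qed
    ultimately have "owner f x"
      unfolding owner_def using xX by blast
    then have "c f \<longleftrightarrow> x \<in> R" unfolding c_def using owner_unique by blast
    then show ?thesis using fS x(2) by blast
  qed
  have "bichromatic mu c"
    unfolding bichromatic_def
  proof (intro allI impI)
    fix S m v
    assume "\<forall>n. \<forall>xs\<in>histories mu n. S xs \<noteq> {} \<and> S xs \<subseteq> {..<mu n}"
      "\<forall>n\<ge>m. \<forall>xs\<in>histories mu n. \<forall>b<mu n. \<exists>c\<in>S xs. b \<le> c"
    then show "\<exists>f. (\<forall>n. f n \<in> S (history f n)) \<and> c f = v"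
      by (intro branch) auto
  qed
  then show ?thesis by blast
qed

end

section \<open>Ordinals, nodes and trees\<close>

lemma Field_below_rel [simp]: "Field (below_rel a) = {..<a}"
  unfolding below_rel_def Field_def by auto

lemma underS_below_rel: "b < a \<Longrightarrow> underS (below_rel a) b = {..<b}"
  unfolding below_rel_def underS_def by auto

lemma card_below_ordLess:
  assumes "Card_order (below_rel a)" "b < a"
  shows "|{..<b}| <o below_rel a"
  using card_of_underS[OF assms(1), of b] assms(2) by (simp add: underS_below_rel)

lemma infinite_cardinal_no_max:
  assumes "infinite_cardinal (below_rel a)" "b < a"
  shows "\<exists>c<a. b < c"
proof -
  have "\<exists>c\<in>{..<a}. b \<noteq> c \<and> (b, c) \<in> below_rel a"
    using infinite_Card_order_limit[of "below_rel a" b] assms unfolding infinite_cardinal_def by simp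
  then show ?thesis unfolding below_rel_def by auto
qed

text \<open>Too small to be cofinal, \<open>K\<close> has a weak upper bound below \<open>a\<close>;
  as there is no largest element below \<open>a\<close>, the bound can be made strict.\<close>

lemma regular_cardinal_bounded:
  assumes "regular_cardinal (below_rel a)" "K \<subseteq> {..<a}" "|K| <o below_rel a"
  shows "\<exists>u<a. \<forall>x\<in>K. x < u"
proof -
  have "\<not> |K| =o below_rel a" using assms(3) not_ordLess_ordIso by blast
  then have "\<not> cofinal K (below_rel a)"
    using assms(1,2) unfolding regular_cardinal_def regularCard_def by auto
  then obtain u where u: "u < a" "\<forall>x\<in>K. x \<le> u"
  proof -
    obtain u where u: "u < a" "\<And>x. x \<in> K \<Longrightarrow> \<not> (u \<noteq> x \<and> (u, x) \<in> below_rel a)"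
      using \<open>\<not> cofinal K (below_rel a)\<close> unfolding cofinal_def by auto
    have "x \<le> u" if "x \<in> K" for x
      using u(2)[OF that] assms(2) that unfolding below_rel_def by fastforce
    then show thesis using u(1) that by blast
  qed
  obtain c where "c < a" "u < c"
    using infinite_cardinal_no_max u(1) assms(1) unfolding regular_cardinal_def by blast
  then show ?thesis using u by (meson le_less_trans)
qed

definition ladder :: "(nat \<Rightarrow> 'a::wellorder) \<Rightarrow> 'a \<Rightarrow> bool" where
  "ladder z d \<longleftrightarrow> (\<forall>n. z n < d \<and> z n < z (Suc n)) \<and> (\<forall>b<d. \<exists>n. b < z n)"

lemma ladder_strict_mono: "ladder z d \<Longrightarrow> strict_mono z"
  unfolding ladder_def by (simp add: strict_mono_Suc_iff)

lemma ladder_imp_limit: "ladder z d \<Longrightarrow> limit_ordinal d"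
  unfolding ladder_def limit_ordinal_def by blast

text \<open>Enumerate the ordinals below \<open>d\<close> and let each rung exceed both the previous
  rung and the next ordinal of the enumeration.\<close>

lemma ladder_exists:
  assumes "limit_ordinal d" "countable {..<d}"
  shows "\<exists>z. ladder z d"
proof -
  have ne: "{..<d} \<noteq> {}" using assms(1) unfolding limit_ordinal_def by blast
  define x where "x = from_nat_into {..<d}"
  have x: "range x = {..<d}" unfolding x_def using ne assms(2) by simp
  have lim: "\<exists>c<d. b < c" if "b < d" for b using assms(1) that unfolding limit_ordinal_def by blast
  have "\<exists>z. \<forall>n. z n < d \<and> (z n < z (Suc n) \<and> x n < z (Suc n))"
  proof (rule dependent_nat_choice)
    show "\<exists>z. z < d" using ne by blast
    show "\<exists>c. c < d \<and> (b < c \<and> x n < c)" if "b < d" for b n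
    proof -
      have "x n < d" using x by blast
      then show ?thesis using lim[of "max b (x n)"] that by auto
    qed
  qed
  then obtain z where z: "\<And>n. z n < d" "\<And>n. z n < z (Suc n)" "\<And>n. x n < z (Suc n)" by blast
  have "\<exists>n. b < z n" if "b < d" for b
  proof -
    have "b \<in> range x" using x that by blast
    then show ?thesis using z(3) by blast
  qed
  then show ?thesis unfolding ladder_def using z by blast
qed

text \<open>The least strict upper bound of the sequence serves as \<open>d\<close>.\<close>

lemma strict_mono_sup_ladder:
  fixes z :: "nat \<Rightarrow> 'a::wellorder"
  assumes "\<And>n. z n < z (Suc n)" "\<And>n. z n < u"
  shows "\<exists>d\<le>u. ladder z d"
proof -
  define d where "d = (LEAST w. \<forall>n. z n < w)"
  have d: "\<forall>n. z n < d" unfolding d_def using assms(2) by (intro LeastI[of "\<lambda>w. \<forall>n. z n < w" u]) blast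
  have "d \<le> u" unfolding d_def using assms(2) by (intro Least_le) blast
  moreover have "\<exists>n. b < z n" if "b < d" for b
  proof -
    have "\<not> (\<forall>n. z n < b)" using not_less_Least[of b "\<lambda>w. \<forall>n. z n < w"] that unfolding d_def by blast
    then obtain n where "b \<le> z n" by (auto simp: not_less)
    then show ?thesis using assms(1)[of n] by (meson le_less_trans)
  qed
  ultimately show ?thesis unfolding ladder_def using d assms(1) by blast
qed

lemma ladder_has_cofinality:
  assumes "ladder z d"
  shows "has_cofinality (below_rel d) natLeq"
  unfolding has_cofinality_def
proof (intro conjI exI allI impI)
  have inj: "inj z" using ladder_strict_mono[OF assms] strict_mono_imp_inj_on by blast
  show "range z \<subseteq> Field (below_rel d)" using assms unfolding ladder_def by auto
  show "cofinal (range z) (below_rel d)"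
    unfolding cofinal_def
  proof
    fix a assume "a \<in> Field (below_rel d)"
    then obtain n where "a < z n" "z n < d" using assms unfolding ladder_def by auto
    then show "\<exists>b\<in>range z. a \<noteq> b \<and> (a, b) \<in> below_rel d" by (auto simp: below_rel_def)
  qed
  have "bij_betw z UNIV (range z)" using inj by (simp add: inj_on_imp_bij_betw)
  then have "|UNIV :: nat set| =o |range z|" using card_of_ordIso by blast
  then show "|range z| =o natLeq"
    using card_of_nat ordIso_symmetric ordIso_transitive by blast
  fix K assume K: "K \<subseteq> Field (below_rel d) \<and> cofinal K (below_rel d)"
  have "infinite K"
  proof
    assume fin: "finite K"
    have cof: "\<exists>b\<in>K. a < b" if a: "a < d" for a
    proof -
      obtain b where "b \<in> K" "a \<noteq> b" "(a, b) \<in> below_rel d"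
        using K a unfolding cofinal_def by auto
      then have "a < b" unfolding below_rel_def by auto
      then show ?thesis using \<open>b \<in> K\<close> by blast
    qed
    then have "K \<noteq> {}" using assms unfolding ladder_def by blast
    then have "Max K \<in> K" using fin by simp
    then have "Max K < d" using K by auto
    then obtain b where "b \<in> K" "Max K < b" using cof by blast
    then show False using fin by (simp add: leD)
  qed
  then show "natLeq \<le>o |K|" using infinite_iff_natLeq_ordLeq by blast
qed

section \<open>Unions and restrictions of sequences\<close>

lemma chain_union:
  fixes T :: "nat \<Rightarrow> 'a \<rightharpoonup> 'b"
  assumes "\<And>k. T k \<subseteq>\<^sub>m T (Suc k)"
  obtains t where "\<And>k. T k \<subseteq>\<^sub>m t" "dom t = (\<Union>k. dom (T k))"
proof -
  have mono: "T i \<subseteq>\<^sub>m T k" if "i \<le> k" for i k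
    using that by (induction rule: dec_induct) (use assms map_le_trans in auto)
  define t where "t x = (if \<exists>k. x \<in> dom (T k) then T (SOME k. x \<in> dom (T k)) x else None)" for x
  have eq: "t x = T k x" if k: "x \<in> dom (T k)" for x k
  proof -
    define i where "i = (SOME k. x \<in> dom (T k))"
    have i: "x \<in> dom (T i)" unfolding i_def using someI[of "\<lambda>k. x \<in> dom (T k)"] k by blast
    have "T i x = T k x"
      using mono[of i k] mono[of k i] i k unfolding map_le_def by (metis nle_le)
    then show ?thesis unfolding t_def i_def[symmetric] using k by auto
  qed
  have "T k \<subseteq>\<^sub>m t" for k unfolding map_le_def using eq by simp
  moreover have "dom t = (\<Union>k. dom (T k))"
  proof
    show "dom t \<subseteq> (\<Union>k. dom (T k))" 
    proof
      fix x assume "x \<in> dom t"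
      then have "\<exists>k. x \<in> dom (T k)" unfolding t_def by (cases "\<exists>k. x \<in> dom (T k)") auto
      then show "x \<in> (\<Union>k. dom (T k))" by blast
    qed
    show "(\<Union>k. dom (T k)) \<subseteq> dom t" 
    proof
      fix x assume "x \<in> (\<Union>k. dom (T k))"
      then obtain k where k: "x \<in> dom (T k)" by blast
      then show "x \<in> dom t" using eq[OF k] by (simp add: dom_def)
    qed
  qed
  ultimately show thesis by (rule that)
qed

text \<open>Either some proper restriction of \<open>f\<close> already extends \<open>s\<close>, or
  all of them are contained in \<open>s\<close>; at a limit they cover \<open>f\<close>.\<close>

lemma limit_comparable:
  assumes d: "limit_ordinal d" and f: "dom f = {..<d}"
    and comp: "\<And>b. b < d \<Longrightarrow> f |` {..<b} \<subseteq>\<^sub>m s \<or> s \<subseteq>\<^sub>m f |` {..<b}"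
  shows "f \<subseteq>\<^sub>m s \<or> s \<subseteq>\<^sub>m f"
proof (cases "\<exists>b<d. s \<subseteq>\<^sub>m f |` {..<b}")
  case True
  then show ?thesis 
  proof -
    obtain b where b: "s \<subseteq>\<^sub>m f |` {..<b}" using True by blast
    have "f |` {..<b} \<subseteq>\<^sub>m f" by (auto simp: map_le_def)
    then show ?thesis using b map_le_trans by blast
  qed
next
  case False
  have "f x = s x" if x: "x \<in> dom f" for x
  proof -
    obtain b where b: "x < b" "b < d" using d f x unfolding limit_ordinal_def by blast
    then have "f |` {..<b} \<subseteq>\<^sub>m s" using comp False by blast
    moreover have "x \<in> dom (f |` {..<b})" using b x by auto
    ultimately have "(f |` {..<b}) x = s x" unfolding map_le_def by blast
    then show ?thesis using b by simp
  qed
  then show ?thesis unfolding map_le_def by blast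
qed

section \<open>Countable ordinals and the regular cardinals\<close>

locale laver_setting =
  fixes lam :: "'a::wellorder" and ks :: "'a \<Rightarrow> 'a"
  assumes lam: "below_rel lam =o cardSuc natLeq"
    and ks_mono: "strict_mono_on {..<lam} ks"
    and ks_regular: "\<And>a. a < lam \<Longrightarrow> regular_cardinal (below_rel (ks a))"
begin

lemma lam_Card_order: "Card_order (below_rel lam)"
  using Card_order_ordIso[OF cardSuc_Card_order[OF natLeq_Card_order] lam] .

lemma segment_countable:
  assumes "a < lam"
  shows "countable {..<a}"
proof -
  have "|{..<a}| <o cardSuc natLeq"
    using card_below_ordLess[OF lam_Card_order assms] lam by (rule ordLess_ordIso_trans)
  then have "|{..<a}| \<le>o natLeq"
    by (rule iffD1[OF cardSuc_ordLeq_ordLess[OF natLeq_Card_order card_of_Card_order]])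
  then show ?thesis
    by (simp only: countable_card_le_natLeq)
qed

lemma card_of_lam: "|{..<lam}| =o cardSuc natLeq"
  using card_of_Field_ordIso[OF lam_Card_order] lam unfolding Field_below_rel
  by (rule ordIso_transitive)

lemma lam_uncountable: "uncountable {..<lam}"
proof
  assume "countable {..<lam}"
  then have "cardSuc natLeq \<le>o natLeq"
    using card_of_lam ordIso_ordLeq_trans ordIso_symmetric unfolding countable_card_le_natLeq by blast
  then show False using cardSuc_greater[OF natLeq_Card_order] not_ordLess_ordLeq by blast
qed

text \<open>Otherwise \<open>lam\<close>, which is \<open>\<omega>\<^sub>1\<close>, would be a
  countable union of countable segments.\<close>

lemma countable_bounded_lam:
  assumes "A \<subseteq> {..<lam}" "countable A"
  shows "\<exists>u<lam. \<forall>a\<in>A. a < u"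
proof (rule ccontr)
  assume "\<not> ?thesis"
  then have "\<exists>a\<in>A. u \<le> a" if "u < lam" for u using that not_less by blast
  then have "{..<lam} \<subseteq> (\<Union>a\<in>A. insert a {..<a})" by (fastforce simp: order.order_iff_strict)
  moreover have "countable (\<Union>a\<in>A. insert a {..<a})"
    using assms segment_countable by auto
  ultimately show False using lam_uncountable countable_subset by blast
qed

text \<open>The type carries only an order, so \<open>{..<a'} = {..a}\<close> is the way to say that
  \<open>a'\<close> is \<open>a + 1\<close>.\<close>

lemma successor_exists:
  assumes "a < lam"
  obtains a' where "a' < lam" "a < a'" "{..<a'} = {..a}"
proof -
  define a' where "a' = (LEAST x. a < x)"
  obtain u where u: "u < lam" "a < u" using countable_bounded_lam[of "{a}"] assms by auto
  have "a < a'" unfolding a'_def using u(2) by (rule LeastI)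
  moreover have "a' \<le> u" unfolding a'_def using u(2) by (rule Least_le)
  moreover have "x \<le> a" if "x < a'" for x
    using not_less_Least[of x "\<lambda>x. a < x"] that unfolding a'_def by auto
  ultimately have "a' < lam" "a < a'" "{..<a'} = {..a}" using u by auto
  then show thesis by (rule that)
qed

lemma ks_infinite: "a < lam \<Longrightarrow> infinite_cardinal (below_rel (ks a))"
  using ks_regular unfolding regular_cardinal_def by blast

lemma ks_Card_order: "a < lam \<Longrightarrow> Card_order (below_rel (ks a))"
  using ks_infinite unfolding infinite_cardinal_def by blast

lemma ks_inhabited: "a < lam \<Longrightarrow> \<exists>b. b < ks a"
  using ks_infinite[of a] unfolding infinite_cardinal_def by (metis Field_below_rel ex_in_conv finite.emptyI lessThan_iff)

lemma ks_card_less: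
  assumes "b < a" "a < lam"
  shows "|{..<ks b}| <o below_rel (ks a)"
  using card_below_ordLess[OF ks_Card_order] assms ks_mono
  by (meson lessThan_iff less_trans strict_mono_onD)

lemma limits_unbounded:
  assumes "a < lam"
  shows "\<exists>d<lam. limit_ordinal d \<and> a < d"
proof -
  have step: "\<exists>c. c < lam \<and> b < c" if "b < lam" for b using successor_exists[OF that] by blast
  have "\<exists>z. \<forall>n. (z n < lam \<and> (n = 0 \<longrightarrow> z n = a)) \<and> z n < z (Suc n)"
    by (rule dependent_nat_choice[where P = "\<lambda>n w. w < lam \<and> (n = 0 \<longrightarrow> w = a)"
          and Q = "\<lambda>n v w. v < w"])
      (use assms step in auto)
  then obtain z where z: "\<And>n. z n < lam" "z 0 = a" "\<And>n. z n < z (Suc n)" by blast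
  obtain u where u: "u < lam" "\<And>n. z n < u"
    using countable_bounded_lam[of "range z"] z(1) by auto
  then obtain d where d: "d \<le> u" "ladder z d" using strict_mono_sup_ladder[of z u] z(3) by blast
  then have "a < d" using z(2) unfolding ladder_def by metis
  then show ?thesis using d u(1) ladder_imp_limit le_less_trans by blast
qed

text \<open>Colours will be read at limit levels; this injection assigns such a level to each
  coordinate of a condition in \<open>Add lam\<close>. It exists because there are uncountably many
  limits below \<open>lam\<close>.\<close>

lemma inject_into_limits:
  obtains e where "inj_on e {..<lam}" "\<forall>b<lam. e b < lam \<and> limit_ordinal (e b)"
proof -
  let ?L = "{d. d < lam \<and> limit_ordinal d}"
  have "uncountable ?L"
  proof
    assume "countable ?L"
    then obtain u where "u < lam" "\<forall>d\<in>?L. d < u" using countable_bounded_lam[of ?L] by auto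
    then show False using limits_unbounded[of u] by force
  qed
  then have "natLeq <o |?L|"
    unfolding countable_card_le_natLeq
    using natLeq_Well_order card_of_Well_order not_ordLeq_iff_ordLess by blast
  then have "cardSuc natLeq \<le>o |?L|"
    using cardSuc_ordLess_ordLeq[OF natLeq_Card_order card_of_Card_order] by blast
  then have "|{..<lam}| \<le>o |?L|" using card_of_lam ordIso_ordLeq_trans by blast
  then obtain e where "inj_on e {..<lam}" "e ` {..<lam} \<subseteq> ?L"
    unfolding card_of_ordLeq[symmetric] by blast
  then show thesis using that[of e] by blast
qed

section \<open>Nodes and immediate successors\<close>

lemma node_dom:
  assumes "t \<in> nodes lam ks"
  shows "dom t = {..<len t}" "len t < lam"
  using assms len_eq unfolding nodes_def by blast+

lemma node_value:
  assumes "t \<in> nodes lam ks" "t b = Some c"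
  shows "c < ks b"
proof -
  obtain a where a: "dom t = {..<a}" "\<forall>b<a. the (t b) < ks b"
    using assms(1) unfolding nodes_def by blast
  have "b < a" using a(1) domI[of t b c] assms(2) by auto
  then show ?thesis using a(2) assms(2) by auto
qed

lemma node_Some: "t \<in> nodes lam ks \<Longrightarrow> b < len t \<Longrightarrow> \<exists>c. t b = Some c"
  using node_dom by (metis domD lessThan_iff)

lemma nodesI:
  assumes "dom t = {..<a}" "a < lam" "\<And>b c. t b = Some c \<Longrightarrow> c < ks b"
  shows "t \<in> nodes lam ks"
proof -
  have "the (t b) < ks b" if "b < a" for b
  proof -
    have "b \<in> dom t" using that assms(1) by simp
    then show ?thesis using assms(3) by auto
  qed
  then show ?thesis using assms(1,2) unfolding nodes_def by blast
qed

lemma map_le_len: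
  assumes "s \<in> nodes lam ks" "t \<in> nodes lam ks" "s \<subseteq>\<^sub>m t"
  shows "len s \<le> len t"
  using map_le_implies_dom_le[OF assms(3)] node_dom(1)[OF assms(1)] node_dom(1)[OF assms(2)] by auto

lemma map_le_len_eq:
  assumes "s \<in> nodes lam ks" "t \<in> nodes lam ks" "s \<subseteq>\<^sub>m t" "len t \<le> len s"
  shows "s = t"
proof -
  have "dom s = dom t"
    using map_le_implies_dom_le[OF assms(3)] node_dom(1)[OF assms(1)] node_dom(1)[OF assms(2)] assms(4)
    by auto
  then show ?thesis using assms(3) by (metis map_le_antisym map_le_def)
qed

lemma restrict_node:
  assumes "t \<in> nodes lam ks" "b \<le> len t"
  shows "t |` {..<b} \<in> nodes lam ks" "len (t |` {..<b}) = b" "t |` {..<b} \<subseteq>\<^sub>m t"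
proof -
  have d: "dom (t |` {..<b}) = {..<b}" using node_dom(1)[OF assms(1)] assms(2) by auto
  show "len (t |` {..<b}) = b" using len_eq[OF d] .
  show "t |` {..<b} \<in> nodes lam ks"
    using d
  proof (rule nodesI)
    show "b < lam" using node_dom(2)[OF assms(1)] assms(2) by simp
    show "c < ks x" if "(t |` {..<b}) x = Some c" for x c
      using that node_value[OF assms(1)] by (auto simp: restrict_map_def split: if_splits)
  qed
  show "t |` {..<b} \<subseteq>\<^sub>m t" by (auto simp: map_le_def)
qed

lemma append_node:
  assumes "t \<in> nodes lam ks" "c < ks (len t)"
  shows "t(len t \<mapsto> c) \<in> nodes lam ks" "{..<len (t(len t \<mapsto> c))} = {..len t}"
    "len t < len (t(len t \<mapsto> c))" "t \<subseteq>\<^sub>m t(len t \<mapsto> c)"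
proof -
  obtain a' where a': "a' < lam" "len t < a'" "{..<a'} = {..len t}"
    by (rule successor_exists[OF node_dom(2)[OF assms(1)]])
  have d: "dom (t(len t \<mapsto> c)) = {..<a'}" using node_dom(1)[OF assms(1)] a'(3) by auto
  show "{..<len (t(len t \<mapsto> c))} = {..len t}" "len t < len (t(len t \<mapsto> c))"
    using len_eq[OF d] a' by auto
  show "t(len t \<mapsto> c) \<in> nodes lam ks"
    using d a'(1) by (rule nodesI) (use assms node_value in \<open>auto split: if_splits\<close>)
  show "t \<subseteq>\<^sub>m t(len t \<mapsto> c)" using node_dom(1)[OF assms(1)] by (auto simp: map_le_def)
qed

lemma tree_nodes: "is_tree lam ks p \<Longrightarrow> t \<in> p \<Longrightarrow> t \<in> nodes lam ks"
  unfolding is_tree_def by blast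

lemma tree_restrict: "is_tree lam ks p \<Longrightarrow> t \<in> p \<Longrightarrow> b \<le> len t \<Longrightarrow> t |` {..<b} \<in> p"
  using restrict_node tree_nodes unfolding is_tree_def by blast

lemma OSucc_less:
  assumes "is_tree lam ks p" "b \<in> OSucc p t"
  shows "b < ks (len t)"
  using assms node_value[OF tree_nodes[OF assms(1)], of "t(len t \<mapsto> b)" "len t" b]
  unfolding OSucc_def by simp

text \<open>A node of \<open>p\<close> properly above \<open>t\<close> restricts to an extension of
  \<open>t\<close> by one value, which lies in \<open>p\<close> since trees are closed under initial
  segments; minimality makes the two equal.\<close>

lemma Succ_eq_image:
  assumes p: "is_tree lam ks p" and t: "t \<in> p"
  shows "Succ p t = (\<lambda>b. t(len t \<mapsto> b)) ` OSucc p t"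
proof (intro set_eqI iffI)
  have tn: "t \<in> nodes lam ks" using tree_nodes[OF p t] .
  note dt = node_dom[OF tn]
  fix u
  {
    assume "u \<in> Succ p t"
    then have u: "u \<in> p" "t \<subseteq>\<^sub>m u" "t \<noteq> u" "\<And>v. \<lbrakk>v \<in> p; t \<subseteq>\<^sub>m v; v \<subseteq>\<^sub>m u\<rbrakk> \<Longrightarrow> v = t \<or> v = u"
      unfolding Succ_def by auto
    have un: "u \<in> nodes lam ks" using tree_nodes[OF p u(1)] .
    have "len t < len u" using map_le_len_eq[OF tn un u(2)] u(3) by force
    then obtain b where b: "u (len t) = Some b" using node_Some[OF un] by blast
    obtain a' where a': "a' < lam" "len t < a'" "{..<a'} = {..len t}"
      by (rule successor_exists[OF dt(2)])
    have "a' \<le> len u"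
    proof (rule ccontr)
      assume "\<not> a' \<le> len u"
      then have "len u \<in> {..<a'}" by simp
      then show False using a'(3) \<open>len t < len u\<close> by auto
    qed
    let ?v = "u |` {..<a'}"
    have v_eq: "?v = t(len t \<mapsto> b)"
    proof
      fix x
      consider "x < len t" | "x = len t" | "x > len t" by fastforce
      then show "?v x = (t(len t \<mapsto> b)) x"
      proof cases
        case 1
        then have "t x = u x" using u(2) dt(1) unfolding map_le_def by blast
        moreover have "x \<in> {..<a'}" using 1 a'(3) by auto
        ultimately show ?thesis using 1 by auto
      next
        case 2
        then show ?thesis using a'(2) b by simp
      next
        case 3
        then have "x \<notin> {..<a'}" "x \<notin> dom t" using a'(3) dt(1) by auto
        then show ?thesis using 3 by (auto simp: restrict_map_def dom_def)
      qed
    qed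
    have "?v \<in> p" using tree_restrict[OF p u(1) \<open>a' \<le> len u\<close>] .
    moreover have "t \<subseteq>\<^sub>m ?v" unfolding v_eq using dt(1) by (auto simp: map_le_def)
    moreover have "?v \<subseteq>\<^sub>m u" by (auto simp: map_le_def)
    moreover have "?v \<noteq> t" unfolding v_eq using dt(1) by (metis domIff fun_upd_same lessThan_iff less_irrefl option.distinct(1))
    ultimately have "?v = u" using u(4) by blast
    then show "u \<in> (\<lambda>b. t(len t \<mapsto> b)) ` OSucc p t"
      using v_eq u(1) unfolding OSucc_def by force
  next
    assume "u \<in> (\<lambda>b. t(len t \<mapsto> b)) ` OSucc p t"
    then obtain b where b: "u = t(len t \<mapsto> b)" "b \<in> OSucc p t" by blast
    then have up: "u \<in> p" unfolding OSucc_def by blast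
    have un: "u \<in> nodes lam ks" using tree_nodes[OF p up] .
    note app = append_node[OF tn OSucc_less[OF p b(2)], folded b(1)]
    have "v = t \<or> v = u" if v: "v \<in> p" "t \<subseteq>\<^sub>m v" "v \<subseteq>\<^sub>m u" for v
    proof -
      have vn: "v \<in> nodes lam ks" using tree_nodes[OF p v(1)] .
      show ?thesis
      proof (cases "len v \<le> len t")
        case True
        then show ?thesis using map_le_len_eq[OF tn vn v(2)] by blast
      next
        case False
        then have "len v \<notin> {..<len u}" using app(2) by auto
        then show ?thesis using map_le_len_eq[OF vn un v(3)] by auto
      qed
    qed
    moreover have "t \<noteq> u" using app(3) by auto
    ultimately show "u \<in> Succ p t" unfolding Succ_def using up app(4) by blast
  }
qed

section \<open>Sizes of successor sets, and stems\<close>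

lemma card_Succ:
  assumes "is_tree lam ks p" "t \<in> p"
  shows "|Succ p t| =o |OSucc p t|"
proof -
  have "inj_on (\<lambda>b. t(len t \<mapsto> b)) (OSucc p t)"
    by (rule inj_onI) (metis fun_upd_same option.inject)
  then show ?thesis
    unfolding Succ_eq_image[OF assms]
    using card_of_ordIso inj_on_imp_bij_betw ordIso_symmetric by blast
qed

text \<open>Since \<open>ks (len t)\<close> is an initial ordinal, a successor set bounded by some
  \<open>b\<close> below it would be too small for a node above the stem.\<close>

lemma OSucc_unbounded:
  assumes p: "is_tree lam ks p" and s: "is_stem ks p s" and t: "t \<in> p" "s \<subseteq>\<^sub>m t"
    and b: "b < ks (len t)"
  shows "\<exists>c\<in>OSucc p t. b \<le> c"
proof (rule ccontr)
  assume "\<not> ?thesis"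
  then have "OSucc p t \<subseteq> {..<b}" by (meson lessThan_iff not_le subsetI)
  then have "|OSucc p t| \<le>o |{..<b}|" by (rule card_of_mono1)
  moreover have "|{..<b}| <o below_rel (ks (len t))"
    using card_below_ordLess[OF ks_Card_order b] node_dom(2)[OF tree_nodes[OF p t(1)]] by blast
  ultimately have less: "|OSucc p t| <o below_rel (ks (len t))" by (rule ordLeq_ordLess_trans)
  have "|Succ p t| =o below_rel (ks (len t))" using s t unfolding is_stem_def by blast
  then have "|OSucc p t| =o below_rel (ks (len t))"
    using card_Succ[OF p t(1)] ordIso_symmetric ordIso_transitive by blast
  then show False using less not_ordLess_ordIso by blast
qed

lemma OSucc_nonempty:
  assumes "is_tree lam ks p" "is_stem ks p s" "t \<in> p" "s \<subseteq>\<^sub>m t"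
  shows "OSucc p t \<noteq> {}"
  using OSucc_unbounded[OF assms] ks_inhabited node_dom(2)[OF tree_nodes[OF assms(1,3)]] by blast

text \<open>If \<open>s'\<close> were strictly shorter than \<open>s\<close>, all its successors in
  \<open>p'\<close> would be comparable with \<open>s\<close> and so would continue with the one
  value \<open>s (len s')\<close>, whereas \<open>s'\<close> has unboundedly many successors. With
  \<open>p' = p\<close> this gives uniqueness of the stem.\<close>

lemma stem_mono:
  assumes p: "is_tree lam ks p" "is_stem ks p s"
    and p': "is_tree lam ks p'" "is_stem ks p' s'" and sub: "p' \<subseteq> p"
  shows "s \<subseteq>\<^sub>m s'"
proof (rule ccontr)
  assume neg: "\<not> s \<subseteq>\<^sub>m s'"
  have s: "s \<in> p" and s': "s' \<in> p'" using p p' unfolding is_stem_def by blast+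
  have sn: "s \<in> nodes lam ks" "s' \<in> nodes lam ks" using tree_nodes s s' p p' by blast+
  have le: "s' \<subseteq>\<^sub>m s" using neg p(2) s' sub unfolding is_stem_def by blast
  have "s' \<noteq> s" using neg by auto
  then have "len s' < len s" using map_le_len_eq[OF sn(2,1) le] by force
  then obtain c where c: "s (len s') = Some c" using node_Some[OF sn(1)] by blast
  have only: "b = c" if b: "b \<in> OSucc p' s'" for b
  proof -
    have "s'(len s' \<mapsto> b) \<in> p" using b sub unfolding OSucc_def by blast
    then have "s'(len s' \<mapsto> b) \<subseteq>\<^sub>m s \<or> s \<subseteq>\<^sub>m s'(len s' \<mapsto> b)" using p(2) unfolding is_stem_def by blast
    then show ?thesis
    proof
      assume "s'(len s' \<mapsto> b) \<subseteq>\<^sub>m s"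
      then have "(s'(len s' \<mapsto> b)) (len s') = s (len s')" unfolding map_le_def by (metis domI fun_upd_same)
      then show ?thesis using c by simp
    next
      assume "s \<subseteq>\<^sub>m s'(len s' \<mapsto> b)"
      then have "s (len s') = (s'(len s' \<mapsto> b)) (len s')" unfolding map_le_def using c by blast
      then show ?thesis using c by simp
    qed
  qed
  have lt: "len s' < lam" using node_dom(2)[OF sn(2)] .
  obtain b where b: "b \<in> OSucc p' s'" using OSucc_nonempty[OF p' s'] by auto
  then have "c < ks (len s')" using only OSucc_less[OF p'(1)] by blast
  then obtain d where d: "d < ks (len s')" "c < d" using infinite_cardinal_no_max[OF ks_infinite[OF lt]] by blast
  obtain b' where "b' \<in> OSucc p' s'" "d \<le> b'" using OSucc_unbounded[OF p' s' _ d(1)] by auto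
  then show False using only d(2) by force
qed

section \<open>Colours at limit levels\<close>

definition rungs :: "'a \<Rightarrow> nat \<Rightarrow> 'a" where
  "rungs d = (SOME z. ladder z d)"

lemma rungs:
  assumes "limit_ordinal d" "d < lam"
  shows "ladder (rungs d) d"
  unfolding rungs_def using someI_ex[OF ladder_exists[OF assms(1) segment_countable[OF assms(2)]]] .

definition colour :: "'a \<Rightarrow> (nat \<Rightarrow> 'a) \<Rightarrow> bool" where
  "colour d = (SOME c. bichromatic (\<lambda>n. ks (rungs d n)) c)"

lemma bichromatic_colour:
  assumes d: "limit_ordinal d" "d < lam"
  shows "bichromatic (\<lambda>n. ks (rungs d n)) (colour d)"
proof -
  note l = rungs[OF d]
  have less: "rungs d n < lam" for n using l d(2) unfolding ladder_def by (meson less_trans)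
  interpret product_of_regulars "\<lambda>n. ks (rungs d n)"
  proof
    fix n
    show "\<exists>b. b < ks (rungs d n)" using ks_inhabited[OF less] .
    show "\<exists>c<ks (rungs d n). b < c" if "b < ks (rungs d n)" for b
      using infinite_cardinal_no_max[OF ks_infinite[OF less] that] .
    fix i g assume i: "i < n" and g: "\<And>b. b < ks (rungs d i) \<Longrightarrow> g b < ks (rungs d n)"
    have "rungs d i < rungs d n" using ladder_strict_mono[OF l] i by (simp add: strict_mono_less)
    then have "|{..<ks (rungs d i)}| <o below_rel (ks (rungs d n))" using ks_card_less less by blast
    then have "|g ` {..<ks (rungs d i)}| <o below_rel (ks (rungs d n))"
      using card_of_image ordLeq_ordLess_trans by blast
    moreover have "g ` {..<ks (rungs d i)} \<subseteq> {..<ks (rungs d n)}" using g by auto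
    ultimately have "\<exists>u<ks (rungs d n). \<forall>x\<in>g ` {..<ks (rungs d i)}. x < u"
      using regular_cardinal_bounded[OF ks_regular[OF less[of n]]] by blast
    then show "\<exists>u<ks (rungs d n). \<forall>b<ks (rungs d i). g b \<le> u" by (auto intro: less_imp_le)
  qed
  show ?thesis unfolding colour_def using bichromatic_exists by (rule someI_ex)
qed

definition node_colour :: "'a \<Rightarrow> ('a \<rightharpoonup> 'a) \<Rightarrow> bool" where
  "node_colour d t = colour d (\<lambda>n. the (t (rungs d n)))"

text \<open>The rungs of \<open>d\<close> lie below \<open>d\<close>, where \<open>t\<close> and
  \<open>u\<close> agree, so both nodes give the same sequence to be coloured.\<close>

lemma node_colour_extend:
  assumes d: "limit_ordinal d" "d \<le> len u" and u: "u \<in> nodes lam ks" "u \<subseteq>\<^sub>m t"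
  shows "node_colour d t = node_colour d u"
proof -
  have "d < lam" using d(2) node_dom(2)[OF u(1)] by simp
  then have "rungs d n < len u" for n using rungs[OF d(1)] d(2) unfolding ladder_def by (meson less_le_trans)
  then have "t (rungs d n) = u (rungs d n)" for n
    using u(2) node_dom(1)[OF u(1)] unfolding map_le_def by (metis lessThan_iff)
  then show ?thesis unfolding node_colour_def by simp
qed

end

section \<open>Extending nodes with prescribed colours\<close>

lemma length_history [simp]: "length (history f n) = n"
  by (induction n) auto

context laver_setting
begin

text \<open>Induction on the target length \<open>a\<close>. A successor step appends any value. At
  a limit, the nodes of \<open>p\<close> at the rungs of \<open>a\<close>, joined by extensions from
  the induction hypothesis, form a tree of histories; bichromaticity selects a branch with colour
  \<open>\<tau> a\<close>, and closure puts its union into \<open>p\<close>.\<close>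

lemma colour_extension:
  assumes p: "closed_tree lam ks p" and s: "is_stem ks p s"
  shows "\<lbrakk>a < lam; u \<in> p; s \<subseteq>\<^sub>m u; len u \<le> a\<rbrakk> \<Longrightarrow> \<exists>t\<in>p. u \<subseteq>\<^sub>m t \<and> len t = a \<and>
    (\<forall>d. limit_ordinal d \<and> len u < d \<and> d \<le> a \<longrightarrow> node_colour d t = \<tau> d)"
proof (induction a arbitrary: u rule: less_induct)
  case (less a)
  have tree: "is_tree lam ks p" using p unfolding closed_tree_def by blast
  note nodes = tree_nodes[OF tree]
  have OS: "OSucc p t \<noteq> {}" if "t \<in> p" "s \<subseteq>\<^sub>m t" for t using OSucc_nonempty[OF tree s that] .
  note IH = less.IH and a = \<open>a < lam\<close> and up = \<open>u \<in> p\<close> and su = \<open>s \<subseteq>\<^sub>m u\<close>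
  consider "len u = a" | "len u < a" "\<not> limit_ordinal a" | "len u < a" "limit_ordinal a"
    using \<open>len u \<le> a\<close> by fastforce
  then show ?case
  proof cases
    case 1
    then show ?thesis using up by (intro bexI[of _ u]) auto
  next
    case 2
    \<comment> \<open>Having predecessors without being a limit, \<open>a\<close> is the successor
      of some \<open>a'\<close>.\<close>
    then obtain a' where a': "a' < a" "\<And>c. a' < c \<Longrightarrow> a \<le> c"
      unfolding limit_ordinal_def by (meson not_le)
    have "len u \<le> a'" using a'(2)[of "len u"] 2(1) by force
    then obtain t where t: "t \<in> p" "u \<subseteq>\<^sub>m t" "len t = a'"
      "\<forall>d. limit_ordinal d \<and> len u < d \<and> d \<le> a' \<longrightarrow> node_colour d t = \<tau> d"
      using IH[OF a'(1) less_trans[OF a'(1) a] up su] by blast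
    have "s \<subseteq>\<^sub>m t" using su t(2) map_le_trans by blast
    then obtain b where b: "b \<in> OSucc p t" using OS t(1) by blast
    let ?v = "t(len t \<mapsto> b)"
    have vp: "?v \<in> p" using b unfolding OSucc_def by blast
    note app = append_node[OF nodes[OF t(1)] OSucc_less[OF tree b]]
    have "len ?v = a"
    proof (rule antisym)
      show "a \<le> len ?v" using a'(2) app(3) t(3) by blast
      show "len ?v \<le> a"
      proof (rule ccontr)
        assume "\<not> len ?v \<le> a"
        then have "a \<in> {..<len ?v}" by simp
        then have "a \<le> a'" using app(2) t(3) by auto
        then show False using a'(1) by simp
      qed
    qed
    moreover have "node_colour d ?v = \<tau> d" if d: "limit_ordinal d" "len u < d" "d \<le> a" for d
    proof -
      have "d \<noteq> a" using d(1) 2(2) by blast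
      then have "d \<le> a'" using a'(2)[of d] d(3) by force
      then show ?thesis
        using node_colour_extend[OF d(1) _ nodes[OF t(1)] app(4)] t(3,4) d(1,2) by simp
    qed
    moreover have "u \<subseteq>\<^sub>m ?v" using t(2) app(4) map_le_trans by blast
    ultimately show ?thesis using vp by blast
  next
    case 3
    define z where "z = rungs a"
    have z: "ladder z a" unfolding z_def using rungs[OF 3(2) a] .
    have z_less: "z n < a" for n using z unfolding ladder_def by blast
    have z_mono: "z i \<le> z k \<longleftrightarrow> i \<le> k" for i k
      using ladder_strict_mono[OF z] by (simp add: strict_mono_less_eq)
    have z_lt: "z i < z k \<longleftrightarrow> i < k" for i k
      using ladder_strict_mono[OF z] by (simp add: strict_mono_less)
    \<comment> \<open>The first \<open>m\<close> stages are spent on a fixed extension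
      \<open>u0\<close> of \<open>u\<close> of length \<open>z m\<close>; the freedom of choice
      begins at rung \<open>m\<close>.\<close>
    obtain m where m: "len u < z m" using z 3(1) unfolding ladder_def by blast
    define good where "good n t \<longleftrightarrow> t \<in> p \<and> u \<subseteq>\<^sub>m t \<and> len t = z n \<and>
      (\<forall>d. limit_ordinal d \<and> len u < d \<and> d \<le> z n \<longrightarrow> node_colour d t = \<tau> d)" for n t
    have goodD: "t \<in> p" "u \<subseteq>\<^sub>m t" "len t = z n" "s \<subseteq>\<^sub>m t"
      "\<And>d. limit_ordinal d \<Longrightarrow> len u < d \<Longrightarrow> d \<le> z n \<Longrightarrow> node_colour d t = \<tau> d"
      if "good n t" for n t
      using that su map_le_trans unfolding good_def by blast+
    have "z m < lam" using z_less[of m] a by simp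
    then obtain u0 where u0: "good m u0"
      using IH[OF z_less[of m] _ up su] less_imp_le[OF m] unfolding good_def by blast
    \<comment> \<open>Append \<open>b\<close> at level \<open>z n\<close> if the tree allows it, and
      an arbitrary successor otherwise; then climb to the next rung by the induction
      hypothesis.\<close>
    have step: "\<exists>t'. good (Suc n) t' \<and> t \<subseteq>\<^sub>m t' \<and> (b \<in> OSucc p t \<longrightarrow> t' (z n) = Some b)"
      if t: "good n t" for n t b
    proof -
      note t = goodD[OF t]
      obtain b' where b': "b' \<in> OSucc p t" "b \<in> OSucc p t \<longrightarrow> b' = b"
        using OS[OF t(1,4)] by blast
      let ?v = "t(len t \<mapsto> b')"
      have vp: "?v \<in> p" using b'(1) unfolding OSucc_def by blast
      note app = append_node[OF nodes[OF t(1)] OSucc_less[OF tree b'(1)]]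
      have tv: "u \<subseteq>\<^sub>m ?v" "s \<subseteq>\<^sub>m ?v" using t(2,4) app(4) map_le_trans by blast+
      have v_len: "len ?v \<le> z (Suc n)"
      proof (rule ccontr)
        assume "\<not> len ?v \<le> z (Suc n)"
        then have "z (Suc n) \<in> {..<len ?v}" by simp
        then have "z (Suc n) \<le> z n" using app(2) t(3) by auto
        then show False using z_mono by simp
      qed
      have "z (Suc n) < lam" using z_less[of "Suc n"] a by simp
      then obtain t' where t': "t' \<in> p" "?v \<subseteq>\<^sub>m t'" "len t' = z (Suc n)"
        "\<forall>d. limit_ordinal d \<and> len ?v < d \<and> d \<le> z (Suc n) \<longrightarrow> node_colour d t' = \<tau> d"
        using IH[OF z_less _ vp tv(2) v_len] by blast
      have tt': "t \<subseteq>\<^sub>m t'" using app(4) t'(2) map_le_trans by blast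
      have "node_colour d t' = \<tau> d" if d: "limit_ordinal d" "len u < d" "d \<le> z (Suc n)" for d
      proof -
        consider "d \<le> len t" | "len t < d" "d \<le> len ?v" | "len ?v < d" by fastforce
        then show ?thesis
        proof cases
          case 1
          then show ?thesis
            using node_colour_extend[OF d(1) 1 nodes[OF t(1)] tt'] t(5)[OF d(1,2)] t(3) by simp
        next
          case 2
          \<comment> \<open>This case is void: \<open>len ?v\<close> is the successor of
            \<open>len t\<close>, and a limit \<open>d\<close> above \<open>len t\<close> lies
            beyond it.\<close>
          obtain c where "len t < c" "c < d" using d(1) 2(1) unfolding limit_ordinal_def by blast
          then have "c \<in> {..<len ?v}" using 2(2) by auto
          then show ?thesis using app(2) \<open>len t < c\<close> by auto
        next
          case 3
          then show ?thesis using t'(4) d by blast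
        qed
      qed
      then have "good (Suc n) t'"
        unfolding good_def using t'(1,3) t(2) tt' map_le_trans by blast
      moreover have "t' (z n) = Some b'"
      proof -
        have "?v (len t) = t' (len t)" using t'(2) unfolding map_le_def by (metis domI fun_upd_same)
        then show ?thesis using t(3) by simp
      qed
      ultimately show ?thesis using tt' b'(2) by blast
    qed
    define ex where "ex n t b = (SOME t'. good (Suc n) t' \<and> t \<subseteq>\<^sub>m t' \<and>
      (b \<in> OSucc p t \<longrightarrow> t' (z n) = Some b))" for n t b
    have ex: "good (Suc n) (ex n t b)" "t \<subseteq>\<^sub>m ex n t b"
      "b \<in> OSucc p t \<Longrightarrow> ex n t b (z n) = Some b" if "good n t" for n t b
      using someI_ex[OF step[OF that, of b]] unfolding ex_def by blast+
    \<comment> \<open>The node reached after a history; it is \<open>u0\<close> for histories of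
      length at most \<open>m\<close> and has length \<open>z (length xs)\<close> from
      \<open>m\<close> on.\<close>
    define nd where "nd = rec_list u0 (\<lambda>b xs t. if length xs < m then u0 else ex (length xs) t b)"
    have nd_Cons: "nd (b # xs) = (if length xs < m then u0 else ex (length xs) (nd xs) b)" for b xs
      unfolding nd_def by simp
    have nd_u0: "length xs \<le> m \<Longrightarrow> nd xs = u0" for xs
      by (cases xs) (auto simp: nd_def)
    have nd_good: "m \<le> length xs \<Longrightarrow> good (length xs) (nd xs)" for xs
    proof (induction xs)
      case Nil
      then show ?case using u0 by (simp add: nd_def)
    next
      case (Cons b xs)
      show ?case
      proof (cases "length xs < m")
        case True
        then have "length (b # xs) = m" using Cons.prems by simp
        then show ?thesis using u0 True by (simp add: nd_Cons)
      next
        case False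
        then show ?thesis using ex(1) Cons.IH by (simp add: nd_Cons)
      qed
    qed
    \<comment> \<open>Below rung \<open>m\<close> the only admissible value is the one that
      \<open>u0\<close> already has, so every branch of \<open>S\<close> is compatible with
      \<open>u0\<close>.\<close>
    define S where "S xs = (if length xs < m then {the (u0 (z (length xs)))} else OSucc p (nd xs))" for xs
    have u0_val: "u0 (z n) = Some (the (u0 (z n)))" "the (u0 (z n)) < ks (z n)" if "n < m" for n
    proof -
      have "z n < len u0" using goodD(3)[OF u0] z_lt that by simp
      then obtain c where "u0 (z n) = Some c" using node_Some nodes goodD(1)[OF u0] by blast
      then show "u0 (z n) = Some (the (u0 (z n)))" "the (u0 (z n)) < ks (z n)"
        using node_value[OF nodes[OF goodD(1)[OF u0]]] by auto
    qed
    have S1: "S xs \<noteq> {} \<and> S xs \<subseteq> {..<ks (z (length xs))}" for xs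
    proof (cases "length xs < m")
      case True
      then show ?thesis using u0_val by (simp add: S_def)
    next
      case False
      then have g: "good (length xs) (nd xs)" using nd_good by simp
      then show ?thesis
        using False OS[OF goodD(1)[OF g] goodD(4)[OF g]] OSucc_less[OF tree, of _ "nd xs"] goodD(3)[OF g]
        unfolding S_def by auto
    qed
    have S2: "\<exists>c\<in>S xs. b \<le> c" if xs: "m \<le> length xs" "b < ks (z (length xs))" for xs b
    proof -
      have g: "good (length xs) (nd xs)" using nd_good xs(1) .
      show ?thesis
        using OSucc_unbounded[OF tree s goodD(1)[OF g] goodD(4)[OF g]] goodD(3)[OF g] xs
        unfolding S_def by simp
    qed
    have "\<exists>f. (\<forall>n. f n \<in> S (history f n)) \<and> colour a f = \<tau> a"
    proof -
      have "\<forall>n. \<forall>xs\<in>histories (\<lambda>n. ks (rungs a n)) n. S xs \<noteq> {} \<and> S xs \<subseteq> {..<ks (rungs a n)}"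
        using S1 length_histories unfolding z_def by blast
      moreover have "\<forall>n\<ge>m. \<forall>xs\<in>histories (\<lambda>n. ks (rungs a n)) n. \<forall>b<ks (rungs a n). \<exists>c\<in>S xs. b \<le> c"
        using S2 length_histories unfolding z_def by blast
      ultimately show ?thesis
        using bichromatic_colour[OF 3(2) a] unfolding bichromatic_def by blast
    qed
    then obtain f where f: "\<And>n. f n \<in> S (history f n)" "colour a f = \<tau> a" by blast
    \<comment> \<open>The nodes along the branch \<open>f\<close>, beginning with \<open>u0\<close>;
      their union takes the value \<open>f n\<close> at each rung \<open>z n\<close>, so its colour
      at \<open>a\<close> is that of \<open>f\<close>.\<close>
    define T where "T k = nd (history f (m + k))" for k
    have T_good: "good (m + k) (T k)" for k
      unfolding T_def using nd_good[of "history f (m + k)"] by simp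
    have T_Suc: "T (Suc k) = ex (m + k) (T k) (f (m + k))" for k
      unfolding T_def by (simp add: nd_Cons)
    have T_le: "T k \<subseteq>\<^sub>m T (Suc k)" for k
      unfolding T_Suc using ex(2)[OF T_good] .
    have T_val: "T (Suc k) (z (m + k)) = Some (f (m + k))" for k
    proof -
      have "f (m + k) \<in> OSucc p (T k)" using f(1)[of "m + k"] unfolding S_def T_def by simp
      then show ?thesis unfolding T_Suc using ex(3)[OF T_good] by blast
    qed
    obtain t where t: "\<And>k. T k \<subseteq>\<^sub>m t" "dom t = (\<Union>k. dom (T k))" using chain_union[of T] T_le by blast
    have T_node: "T k \<in> nodes lam ks" "len (T k) = z (m + k)" for k
      using nodes goodD(1,3)[OF T_good] by blast+
    have reach: "\<exists>k. b < z (m + k)" if b: "b < a" for b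
    proof -
      obtain n where n: "b < z n" using z b unfolding ladder_def by blast
      have "z n \<le> z (m + n)" using z_mono by simp
      then show ?thesis using n less_le_trans by blast
    qed
    have "dom t = {..<a}"
    proof -
      have "dom (T k) = {..<z (m + k)}" for k using node_dom(1)[OF T_node(1)] T_node(2) by simp
      then have "dom t = (\<Union>k. {..<z (m + k)})" using t(2) by simp
      also have "\<dots> = {..<a}" using reach z_less by (auto intro: less_trans)
      finally show ?thesis .
    qed
    have eq_T: "t x = T k x" if "x < z (m + k)" for x k
      using t(1)[of k] that node_dom(1)[OF T_node(1)] T_node(2) unfolding map_le_def by auto
    have "t |` {..<b} \<in> p" if b: "b < a" for b
    proof -
      obtain k where k: "b < z (m + k)" using reach[OF b] by blast
      have "t |` {..<b} = T k |` {..<b}"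
        using eq_T[of _ k] k by (auto simp: restrict_map_def fun_eq_iff)
      moreover have "T k |` {..<b} \<in> p"
        using tree_restrict[OF tree goodD(1)[OF T_good]] k T_node(2) by simp
      ultimately show ?thesis by simp
    qed
    then have tp: "t \<in> p"
      using p a 3(2) \<open>dom t = {..<a}\<close> unfolding closed_tree_def by blast
    have tl: "len t = a" using len_eq[OF \<open>dom t = {..<a}\<close>] .
    have "u \<subseteq>\<^sub>m t" using goodD(2)[OF T_good] t(1) map_le_trans by blast
    have t_val: "t (z n) = Some (f n)" for n
    proof (cases "n < m")
      case True
      have "T 0 = u0" unfolding T_def using nd_u0 by simp
      moreover have "z n < z (m + 0)" using z_lt True by simp
      ultimately have "t (z n) = u0 (z n)" using eq_T[of "z n" 0] by simp
      moreover have "f n = the (u0 (z n))" using f(1)[of n] True unfolding S_def by simp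
      ultimately show ?thesis using u0_val(1)[OF True] by simp
    next
      case False
      then obtain k where k: "n = m + k" using le_Suc_ex not_less by blast
      have "z n < z (m + Suc k)" using z_lt k by simp
      then show ?thesis using eq_T[of "z n" "Suc k"] T_val[of k] k by simp
    qed
    have "node_colour d t = \<tau> d" if d: "limit_ordinal d" "len u < d" "d \<le> a" for d
    proof (cases "d = a")
      case True
      then show ?thesis using f(2) t_val unfolding node_colour_def z_def by simp
    next
      case False
      then have "d < a" using d(3) by simp
      then obtain k where k: "d < z (m + k)" using reach by blast
      then show ?thesis
        using node_colour_extend[OF d(1) _ T_node(1) t(1), of k] goodD(5)[OF T_good d(1,2), of k] T_node(2)
        by simp
    qed
    then show ?thesis using tp tl \<open>u \<subseteq>\<^sub>m t\<close> by blast
  qed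
qed

section \<open>Restricting a tree to a node\<close>

definition cone :: "('a \<rightharpoonup> 'a) set \<Rightarrow> ('a \<rightharpoonup> 'a) \<Rightarrow> ('a \<rightharpoonup> 'a) set" where
  "cone p t = {u \<in> p. u \<subseteq>\<^sub>m t \<or> t \<subseteq>\<^sub>m u}"

lemma map_le_common_upper:
  assumes "s \<in> nodes lam ks" "t \<in> nodes lam ks" "s \<subseteq>\<^sub>m u" "t \<subseteq>\<^sub>m u"
  shows "s \<subseteq>\<^sub>m t \<or> t \<subseteq>\<^sub>m s"
proof -
  have "dom s \<subseteq> dom t \<or> dom t \<subseteq> dom s"
    using node_dom(1)[OF assms(1)] node_dom(1)[OF assms(2)] by auto
  then show ?thesis using assms(3,4) unfolding map_le_def by (metis subsetD)
qed

lemma closed_tree_cone: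
  assumes p: "closed_tree lam ks p" and t: "t \<in> p"
  shows "closed_tree lam ks (cone p t)"
proof -
  have tree: "is_tree lam ks p" using p unfolding closed_tree_def by blast
  note nodes = tree_nodes[OF tree]
  have "is_tree lam ks (cone p t)"
    unfolding is_tree_def
  proof (intro conjI ballI impI)
    show "cone p t \<noteq> {}" using t unfolding cone_def by auto
    show "cone p t \<subseteq> nodes lam ks" using nodes unfolding cone_def by blast
    fix u s assume u: "u \<in> cone p t" and s: "s \<in> nodes lam ks" "s \<subseteq>\<^sub>m u"
    have "s \<in> p" using u s tree unfolding cone_def is_tree_def by blast
    moreover have "s \<subseteq>\<^sub>m t \<or> t \<subseteq>\<^sub>m s"
      using u s nodes[OF t] map_le_common_upper[OF s(1) nodes[OF t]] map_le_trans
      unfolding cone_def by blast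
    ultimately show "s \<in> cone p t" unfolding cone_def by blast
  qed
  moreover have "\<exists>v\<in>cone p t. u \<subseteq>\<^sub>m v \<and> u \<noteq> v" if u: "u \<in> cone p t" for u
  proof (cases "t \<subseteq>\<^sub>m u")
    case True
    obtain v where "v \<in> p" "u \<subseteq>\<^sub>m v" "u \<noteq> v"
      using p u unfolding closed_tree_def cone_def by blast
    then show ?thesis using True map_le_trans unfolding cone_def by blast
  next
    case False
    then show ?thesis using u t unfolding cone_def by (intro bexI[of _ t]) auto
  qed
  moreover have "f \<in> cone p t"
    if d: "d < lam" "limit_ordinal d" and f: "dom f = {..<d}" "\<forall>b<d. f |` {..<b} \<in> cone p t" for d f
  proof -
    have "f \<in> p" using p d f unfolding closed_tree_def cone_def by blast
    moreover have "f \<subseteq>\<^sub>m t \<or> t \<subseteq>\<^sub>m f"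
      using limit_comparable[OF d(2) f(1), of t] f(2) unfolding cone_def by blast
    ultimately show ?thesis unfolding cone_def by blast
  qed
  ultimately show ?thesis unfolding closed_tree_def by blast
qed

lemma Succ_cone:
  assumes "t \<subseteq>\<^sub>m u"
  shows "Succ (cone p t) u = Succ p u"
proof -
  have "v \<in> cone p t \<longleftrightarrow> v \<in> p" if "u \<subseteq>\<^sub>m v" for v
    using map_le_trans[OF assms that] unfolding cone_def by blast
  then show ?thesis unfolding Succ_def by blast
qed

lemma OSucc_cone:
  assumes "t \<subseteq>\<^sub>m u" "u \<in> nodes lam ks"
  shows "OSucc (cone p t) u = OSucc p u"
proof -
  have "u \<subseteq>\<^sub>m u(len u \<mapsto> b)" for b using node_dom(1)[OF assms(2)] by (auto simp: map_le_def)
  then have "t \<subseteq>\<^sub>m u(len u \<mapsto> b)" for b using assms(1) map_le_trans by blast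
  then show ?thesis unfolding OSucc_def cone_def by blast
qed

lemma is_stem_cone:
  assumes s: "is_stem ks p s" and t: "t \<in> p" "s \<subseteq>\<^sub>m t"
  shows "is_stem ks (cone p t) t"
proof -
  have "|Succ (cone p t) u| =o below_rel (ks (len u))" if u: "u \<in> cone p t" "t \<subseteq>\<^sub>m u" for u
  proof -
    have "u \<in> p" "s \<subseteq>\<^sub>m u" using u(1) map_le_trans[OF t(2) u(2)] unfolding cone_def by blast+
    then show ?thesis using s Succ_cone[OF u(2)] unfolding is_stem_def by simp
  qed
  then show ?thesis using t(1) unfolding is_stem_def cone_def by auto
qed

section \<open>Trees with successor sets prescribed level by level\<close>

definition branching_tree :: "('a \<rightharpoonup> 'a) \<Rightarrow> ('a \<Rightarrow> 'a set) \<Rightarrow> ('a \<rightharpoonup> 'a) set" where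
  "branching_tree s A = {t \<in> nodes lam ks. (t \<subseteq>\<^sub>m s \<or> s \<subseteq>\<^sub>m t) \<and>
     (\<forall>b c. t b = Some c \<and> len s \<le> b \<longrightarrow> c \<in> A b)}"

context
  fixes s A
  assumes s: "s \<in> nodes lam ks"
    and A: "\<forall>b. len s \<le> b \<and> b < lam \<longrightarrow> A b \<subseteq> {..<ks b} \<and> |A b| =o below_rel (ks b)"
begin

lemma s_in_branching_tree: "s \<in> branching_tree s A"
proof -
  have "\<not> len s \<le> b" if "s b = Some c" for b c
  proof -
    have "b \<in> dom s" using that by blast
    then show ?thesis using node_dom(1)[OF s] by simp
  qed
  then show ?thesis using s unfolding branching_tree_def by auto
qed

lemma OSucc_branching_tree:
  assumes t: "t \<in> branching_tree s A" "s \<subseteq>\<^sub>m t"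
  shows "OSucc (branching_tree s A) t = A (len t)"
proof -
  have tn: "t \<in> nodes lam ks" using t(1) unfolding branching_tree_def by blast
  have le: "len s \<le> len t" using map_le_len[OF s tn t(2)] .
  have Al: "A (len t) \<subseteq> {..<ks (len t)}" using A le node_dom(2)[OF tn] by blast
  have "b \<in> A (len t)" if b: "t(len t \<mapsto> b) \<in> branching_tree s A" for b
    using b le unfolding branching_tree_def by auto
  moreover have "t(len t \<mapsto> b) \<in> branching_tree s A" if b: "b \<in> A (len t)" for b
  proof -
    have "b < ks (len t)" using b Al by blast
    note app = append_node[OF tn this]
    have "s \<subseteq>\<^sub>m t(len t \<mapsto> b)" using t(2) app(4) map_le_trans by blast
    moreover have "c \<in> A x" if "(t(len t \<mapsto> b)) x = Some c" "len s \<le> x" for x c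
      using that b t(1) unfolding branching_tree_def by (auto split: if_splits)
    ultimately show ?thesis using app(1) unfolding branching_tree_def by blast
  qed
  ultimately show ?thesis unfolding OSucc_def by blast
qed

lemma is_tree_branching_tree: "is_tree lam ks (branching_tree s A)"
  unfolding is_tree_def
proof (intro conjI ballI impI)
  show "branching_tree s A \<noteq> {}" using s_in_branching_tree by blast
  show "branching_tree s A \<subseteq> nodes lam ks" unfolding branching_tree_def by blast
  fix t u assume t: "t \<in> branching_tree s A" and u: "u \<in> nodes lam ks" "u \<subseteq>\<^sub>m t"
  have "u \<subseteq>\<^sub>m s \<or> s \<subseteq>\<^sub>m u"
    using t u map_le_common_upper[OF u(1) s] map_le_trans unfolding branching_tree_def by blast
  moreover have "c \<in> A b" if "u b = Some c" "len s \<le> b" for b c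
  proof -
    have "t b = Some c" using u(2) that(1) unfolding map_le_def by (metis domI)
    then show ?thesis using t that(2) unfolding branching_tree_def by blast
  qed
  ultimately show "u \<in> branching_tree s A" using u(1) unfolding branching_tree_def by blast
qed

lemma is_stem_branching_tree: "is_stem ks (branching_tree s A) s"
proof -
  have "|Succ (branching_tree s A) t| =o below_rel (ks (len t))"
    if t: "t \<in> branching_tree s A" "s \<subseteq>\<^sub>m t" for t
  proof -
    have tn: "t \<in> nodes lam ks" using t(1) unfolding branching_tree_def by blast
    have "|OSucc (branching_tree s A) t| =o below_rel (ks (len t))"
      unfolding OSucc_branching_tree[OF t]
      using A map_le_len[OF s tn t(2)] node_dom(2)[OF tn] by blast
    then show ?thesis using card_Succ[OF is_tree_branching_tree t(1)] ordIso_transitive by blast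
  qed
  then show ?thesis using s_in_branching_tree unfolding is_stem_def branching_tree_def by blast
qed

lemma closed_tree_branching_tree: "closed_tree lam ks (branching_tree s A)"
proof -
  have "\<exists>v\<in>branching_tree s A. t \<subseteq>\<^sub>m v \<and> t \<noteq> v" if t: "t \<in> branching_tree s A" for t
  proof (cases "s \<subseteq>\<^sub>m t")
    case True
    have tn: "t \<in> nodes lam ks" using t unfolding branching_tree_def by blast
    obtain b where b: "b \<in> OSucc (branching_tree s A) t"
      using OSucc_nonempty[OF is_tree_branching_tree is_stem_branching_tree t True] by blast
    note app = append_node[OF tn OSucc_less[OF is_tree_branching_tree b]]
    then have "t \<noteq> t(len t \<mapsto> b)" by (metis less_irrefl)
    then show ?thesis using b app(4) unfolding OSucc_def by blast
  next
    case False
    then show ?thesis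
      using t s_in_branching_tree unfolding branching_tree_def by (intro bexI[of _ s]) auto
  qed
  moreover have "f \<in> branching_tree s A"
    if d: "d < lam" "limit_ordinal d" and f: "dom f = {..<d}" "\<forall>b<d. f |` {..<b} \<in> branching_tree s A"
    for d f
  proof -
    have comp: "f \<subseteq>\<^sub>m s \<or> s \<subseteq>\<^sub>m f"
      using limit_comparable[OF d(2) f(1), of s] f(2) unfolding branching_tree_def by blast
    have below: "\<exists>c'<d. (f |` {..<c'}) b = Some c" if b: "f b = Some c" for b c
    proof -
      have "b < d" using f(1) b by blast
      then obtain c' where "b < c'" "c' < d" using d(2) unfolding limit_ordinal_def by blast
      then show ?thesis using b by (intro exI[of _ c']) simp
    qed
    have "f \<in> nodes lam ks"
    proof (rule nodesI[OF f(1) d(1)])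
      fix b c assume "f b = Some c"
      then obtain c' where c': "c' < d" "(f |` {..<c'}) b = Some c" using below by blast
      then have "f |` {..<c'} \<in> nodes lam ks" using f(2) unfolding branching_tree_def by blast
      then show "c < ks b" using c'(2) by (rule node_value)
    qed
    moreover have "c \<in> A b" if "f b = Some c" "len s \<le> b" for b c
      using below[OF that(1)] f(2) that(2) unfolding branching_tree_def by blast
    ultimately show ?thesis using comp unfolding branching_tree_def by blast
  qed
  ultimately show ?thesis using is_tree_branching_tree unfolding closed_tree_def by blast
qed

end

section \<open>Stationary sets and clubs in the regular cardinals\<close>

lemma stationary_cofinality_omega:
  assumes b: "b < a" "a < lam"
  shows "stationary_in {x. x < ks a \<and> has_cofinality (below_rel x) natLeq} (ks a)"
  unfolding stationary_in_def
proof (intro conjI allI impI)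
  show "{x. x < ks a \<and> has_cofinality (below_rel x) natLeq} \<subseteq> {..<ks a}" by blast
  fix C assume C: "club_in C (ks a)"
  \<comment> \<open>The supremum of an increasing \<omega>-sequence in \<open>C\<close> will be the
    common point. It stays below \<open>ks a\<close> because \<open>b < a\<close> makes
    \<open>ks a\<close> larger than the infinite \<open>ks b\<close>, hence uncountable.\<close>
  have step: "\<exists>c'\<in>C. c < c'" if "c \<in> C" for c
    using C that unfolding club_in_def by blast
  have "b < lam" using b by simp
  have "\<exists>c. c \<in> C" using C ks_inhabited[OF b(2)] unfolding club_in_def by blast
  then have "\<exists>z. \<forall>n. z n \<in> C \<and> z n < z (Suc n)"
    by (intro dependent_nat_choice) (use step in auto)
  then obtain z where z: "\<And>n::nat. z n \<in> C" "\<And>n. z n < z (Suc n)" by blast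
  have "countable (range z)" by simp
  then have "|range z| \<le>o natLeq" by (simp only: countable_card_le_natLeq)
  moreover have "natLeq \<le>o |{..<ks b}|"
    using ks_infinite[OF \<open>b < lam\<close>] infinite_iff_natLeq_ordLeq[of "{..<ks b}"]
    unfolding infinite_cardinal_def Field_below_rel by blast
  ultimately have "|range z| \<le>o |{..<ks b}|" by (rule ordLeq_transitive)
  then have "|range z| <o below_rel (ks a)" using ks_card_less[OF b] by (rule ordLeq_ordLess_trans)
  moreover have "range z \<subseteq> {..<ks a}" using z(1) C unfolding club_in_def by blast
  ultimately obtain u where u: "u < ks a" "\<And>n. z n < u"
    using regular_cardinal_bounded[OF ks_regular[OF b(2)], of "range z"] by auto
  then obtain d where d: "d \<le> u" "ladder z d" using strict_mono_sup_ladder[of z u] z(2) by blast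
  have "d < ks a" using d(1) u(1) by simp
  moreover have "\<exists>c\<in>C. x < c \<and> c < d" if "x < d" for x
    using d(2) z(1) that unfolding ladder_def by blast
  ultimately have "d \<in> C"
    using C ladder_imp_limit[OF d(2)] unfolding club_in_def by blast
  then show "{x. x < ks a \<and> has_cofinality (below_rel x) natLeq} \<inter> C \<noteq> {}"
    using ladder_has_cofinality[OF d(2)] \<open>d < ks a\<close> by blast
qed

lemma club_in_interval:
  assumes "a < lam" "b < ks a"
  shows "club_in {c. b < c \<and> c < ks a} (ks a)"
  unfolding club_in_def
proof (intro conjI allI impI)
  show "{c. b < c \<and> c < ks a} \<subseteq> {..<ks a}" by blast
  show "\<exists>c\<in>{c. b < c \<and> c < ks a}. x < c" if "x < ks a" for x
  proof -
    obtain c where "c < ks a" "max b x < c"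
      using infinite_cardinal_no_max[OF ks_infinite[OF assms(1)], of "max b x"] assms(2) \<open>x < ks a\<close>
      by auto
    then show ?thesis by auto
  qed
  fix d assume d: "d < ks a" "limit_ordinal d \<and> (\<forall>x<d. \<exists>c\<in>{c. b < c \<and> c < ks a}. x < c \<and> c < d)"
  then obtain c where "b < c" "c < d" unfolding limit_ordinal_def by blast
  then show "d \<in> {c. b < c \<and> c < ks a}" using d(1) by auto
qed

text \<open>End segments are clubs, so a stationary set is cofinal, and regularity gives it full
  size.\<close>

lemma card_stationary:
  assumes a: "a < lam" and S: "stationary_in S (ks a)"
  shows "|S| =o below_rel (ks a)"
proof -
  have sub: "S \<subseteq> {..<ks a}" using S unfolding stationary_in_def by blast
  have "cofinal S (below_rel (ks a))"
    unfolding cofinal_def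
  proof
    fix b assume "b \<in> Field (below_rel (ks a))"
    then have "S \<inter> {c. b < c \<and> c < ks a} \<noteq> {}"
      using S club_in_interval[OF a, of b] unfolding stationary_in_def by simp
    then show "\<exists>c\<in>S. b \<noteq> c \<and> (b, c) \<in> below_rel (ks a)" unfolding below_rel_def by auto
  qed
  then show ?thesis
    using sub ks_regular[OF a] unfolding regular_cardinal_def regularCard_def by simp
qed

text \<open>A node of length one. The level \<open>b\<close> below its length makes the later
  cardinals uncountable; no limit ordinal is at most one, so the node carries no colour yet.\<close>

lemma singleton_node:
  obtains s b where "s \<in> nodes lam ks" "b < len s" "\<forall>d. limit_ordinal d \<longrightarrow> \<not> d \<le> len s"
proof -
  define z where "z = (LEAST x::'a. True)"
  have z_le: "z \<le> x" for x unfolding z_def by (rule Least_le) simp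
  have "{..<lam} \<noteq> {}" using lam_uncountable by auto
  then obtain l where "l < lam" by blast
  then have zl: "z < lam" using z_le[of l] by simp
  then obtain c where c: "c < ks z" using ks_inhabited by blast
  have e: "Map.empty \<in> nodes lam ks" "len (Map.empty :: 'a \<rightharpoonup> 'a) = z"
  proof -
    have d: "dom (Map.empty :: 'a \<rightharpoonup> 'a) = {..<z}" using z_le leD by auto
    show "len (Map.empty :: 'a \<rightharpoonup> 'a) = z" using len_eq[OF d] .
    show "Map.empty \<in> nodes lam ks" using nodesI[OF d zl] by simp
  qed
  let ?s = "Map.empty(z \<mapsto> c)"
  note app = append_node[OF e(1), unfolded e(2), OF c]
  have "\<not> d \<le> len ?s" if d: "limit_ordinal d" for d
  proof
    assume "d \<le> len ?s"
    have "z < d" using d z_le unfolding limit_ordinal_def by (meson le_less_trans)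
    then obtain x where x: "z < x" "x < d" using d unfolding limit_ordinal_def by blast
    then have "x \<in> {..<len ?s}" using \<open>d \<le> len ?s\<close> by auto
    then show False using app(2) x(1) by auto
  qed
  then show thesis using that[OF app(1,3)] by blast
qed

end

section \<open>The projection\<close>

context laver_setting
begin

lemma in_LaverD:
  assumes "P \<in> {Laver lam ks, Laver_stat lam ks, Laver_club lam ks}" "p \<in> P"
  shows "closed_tree lam ks p" "is_tree lam ks p" "\<exists>s. is_stem ks p s"
  using assms unfolding Laver_def Laver_stat_def Laver_club_def closed_tree_def by auto

text \<open>Above \<open>t\<close> the cone has the same successor sets as \<open>p\<close>. The
  stem that witnesses membership of \<open>p\<close> in \<open>P\<close> is \<open>s\<close> by
  uniqueness, so its demands hold at all nodes above \<open>t\<close>.\<close>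

lemma cone_in_forcing:
  assumes P: "P \<in> {Laver lam ks, Laver_stat lam ks, Laver_club lam ks}" and p: "p \<in> P"
    and s: "is_stem ks p s" and t: "t \<in> p" "s \<subseteq>\<^sub>m t"
  shows "cone p t \<in> P"
proof -
  note closed = in_LaverD(1)[OF P p] and tree = in_LaverD(2)[OF P p]
  have unique: "s' = s" if "is_stem ks p s'" for s'
    using stem_mono[OF tree that tree s] stem_mono[OF tree s tree that] map_le_antisym by blast
  have c: "closed_tree lam ks (cone p t)" "is_stem ks (cone p t) t"
    using closed_tree_cone[OF closed t(1)] is_stem_cone[OF s t] .
  have above: "u \<in> p \<and> s \<subseteq>\<^sub>m u \<and> OSucc (cone p t) u = OSucc p u"
    if u: "u \<in> cone p t" "t \<subseteq>\<^sub>m u" for u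
  proof -
    have "u \<in> p" using u(1) unfolding cone_def by blast
    then show ?thesis
      using OSucc_cone[OF u(2) tree_nodes[OF tree]] map_le_trans[OF t(2) u(2)] by blast
  qed
  consider "P = Laver lam ks" | "P = Laver_stat lam ks" | "P = Laver_club lam ks" using P by blast
  then show ?thesis
  proof cases
    case 1
    then show ?thesis using c unfolding Laver_def by blast
  next
    case 2
    then obtain s' where s': "is_stem ks p s'" and st: "\<forall>u\<in>p. s' \<subseteq>\<^sub>m u \<longrightarrow>
        OSucc p u \<subseteq> {b. b < ks (len u) \<and> has_cofinality (below_rel b) natLeq} \<and>
        stationary_in (OSucc p u) (ks (len u))"
      using p unfolding Laver_stat_def by blast
    have "\<forall>u\<in>cone p t. t \<subseteq>\<^sub>m u \<longrightarrow>
        OSucc (cone p t) u \<subseteq> {b. b < ks (len u) \<and> has_cofinality (below_rel b) natLeq} \<and>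
        stationary_in (OSucc (cone p t) u) (ks (len u))"
      using above st unique[OF s'] by simp
    then show ?thesis using c unfolding 2 Laver_stat_def by blast
  next
    case 3
    then obtain s' where s': "is_stem ks p s'"
      and cl: "\<forall>u\<in>p. s' \<subseteq>\<^sub>m u \<longrightarrow> (\<exists>C. club_in C (ks (len u)) \<and> C \<subseteq> OSucc p u)"
      using p unfolding Laver_club_def by blast
    have "\<forall>u\<in>cone p t. t \<subseteq>\<^sub>m u \<longrightarrow> (\<exists>C. club_in C (ks (len u)) \<and> C \<subseteq> OSucc (cone p t) u)"
      using above cl unique[OF s'] by simp
    then show ?thesis using c unfolding 3 Laver_club_def by blast
  qed
qed

text \<open>
  The stem has length \<open>1\<close>, since \<open>\<kappa>\<^sub>0\<close> may be \<open>\<omega>\<close>, which has no stationary set of points of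
  cofinality \<open>\<omega>\<close>.
\<close>

lemma short_stem_condition:
  assumes P: "P \<in> {Laver lam ks, Laver_stat lam ks, Laver_club lam ks}"
  shows "\<exists>p\<in>P. \<exists>s. is_stem ks p s \<and> (\<forall>d. limit_ordinal d \<longrightarrow> \<not> d \<le> len s)"
proof -
  obtain s b where s: "s \<in> nodes lam ks" "b < len s" "\<forall>d. limit_ordinal d \<longrightarrow> \<not> d \<le> len s"
    by (rule singleton_node)
  define A0 where "A0 a = {x. x < ks a \<and> has_cofinality (below_rel x) natLeq}" for a
  define A1 where "A1 a = {..<ks a}" for a
  have stat: "stationary_in (A0 a) (ks a)" if "len s \<le> a" "a < lam" for a
    unfolding A0_def using stationary_cofinality_omega[of b a] s(2) that by simp
  have A0: "\<forall>a. len s \<le> a \<and> a < lam \<longrightarrow> A0 a \<subseteq> {..<ks a} \<and> |A0 a| =o below_rel (ks a)"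
    using card_stationary stat unfolding A0_def by fastforce
  have A1: "\<forall>a. len s \<le> a \<and> a < lam \<longrightarrow> A1 a \<subseteq> {..<ks a} \<and> |A1 a| =o below_rel (ks a)"
    using card_of_Field_ordIso[OF ks_Card_order] unfolding A1_def by simp
  have above: "len s \<le> len t \<and> len t < lam" if "t \<in> branching_tree s A" "s \<subseteq>\<^sub>m t" for A t
    using map_le_len[OF s(1) _ that(2)] node_dom(2) that(1) unfolding branching_tree_def by blast
  have "branching_tree s A0 \<in> Laver_stat lam ks"
    unfolding Laver_stat_def
  proof (intro CollectI conjI exI[of _ s] ballI impI)
    show "closed_tree lam ks (branching_tree s A0)" "is_stem ks (branching_tree s A0) s"
      using closed_tree_branching_tree[OF s(1) A0] is_stem_branching_tree[OF s(1) A0] .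
    fix t assume t: "t \<in> branching_tree s A0" "s \<subseteq>\<^sub>m t"
    note O = OSucc_branching_tree[OF s(1) A0 t]
    show "OSucc (branching_tree s A0) t \<subseteq> {b. b < ks (len t) \<and> has_cofinality (below_rel b) natLeq}"
      unfolding O A0_def by blast
    show "stationary_in (OSucc (branching_tree s A0) t) (ks (len t))"
      unfolding O using stat above[OF t] by blast
  qed
  moreover have "branching_tree s A1 \<in> Laver_club lam ks"
  proof -
    have "\<exists>C. club_in C (ks (len t)) \<and> C \<subseteq> OSucc (branching_tree s A1) t"
      if t: "t \<in> branching_tree s A1" "s \<subseteq>\<^sub>m t" for t
    proof -
      obtain x where "x < ks (len t)" using ks_inhabited above[OF t] by blast
      then show ?thesis
        using club_in_interval[of "len t" x] above[OF t] OSucc_branching_tree[OF s(1) A1 t]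
        unfolding A1_def by auto
    qed
    then show ?thesis
      unfolding Laver_club_def
      using closed_tree_branching_tree[OF s(1) A1] is_stem_branching_tree[OF s(1) A1] by blast
  qed
  moreover have "is_stem ks (branching_tree s A0) s" "is_stem ks (branching_tree s A1) s"
    using is_stem_branching_tree[OF s(1) A0] is_stem_branching_tree[OF s(1) A1] .
  moreover have "Laver_stat lam ks \<subseteq> Laver lam ks"
    unfolding Laver_stat_def Laver_def by blast
  ultimately show ?thesis using P s(3) by blast
qed

text \<open>A condition is sent to the colours of its stem. Passing to a cone lengthens the stem,
  and \<open>colour_extension\<close> supplies a longer node with the colours demanded by
  \<open>q\<close>.\<close>

lemma Add_completely_embeds:
  assumes P: "P \<in> {Laver lam ks, Laver_stat lam ks, Laver_club lam ks}"
  shows "completely_embeds (Add lam) (\<lambda>q p. p \<subseteq>\<^sub>m q) P (\<subseteq>)"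
proof -
  obtain e where inj: "inj_on e {..<lam}" and lim: "\<forall>b<lam. e b < lam \<and> limit_ordinal (e b)"
    by (rule inject_into_limits)
  note e = inj lim[rule_format]
  define stem where "stem p = (SOME s. is_stem ks p s)" for p
  \<comment> \<open>Coordinate \<open>b\<close> becomes defined once the stem is long enough to have
    a colour at level \<open>e b\<close>.\<close>
  define proj where "proj s = (\<lambda>b. if b < lam \<and> e b \<le> len s then Some (node_colour (e b) s) else None)" for s
  have stem: "is_stem ks p (stem p)" if "p \<in> P" for p
    unfolding stem_def using someI_ex[OF in_LaverD(3)[OF P that]] .
  have stem_in: "stem p \<in> p" if "p \<in> P" for p using stem[OF that] unfolding is_stem_def by blast
  have stem_eq: "stem p = s" if "p \<in> P" "is_stem ks p s" for p s
    using stem_mono[OF in_LaverD(2)[OF P that(1)] stem[OF that(1)] in_LaverD(2)[OF P that(1)] that(2)]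
      stem_mono[OF in_LaverD(2)[OF P that(1)] that(2) in_LaverD(2)[OF P that(1)] stem[OF that(1)]]
      map_le_antisym by blast
  have stem_node: "stem p \<in> nodes lam ks" if "p \<in> P" for p
    using tree_nodes[OF in_LaverD(2)[OF P that] stem_in[OF that]] .
  have proj_mono: "proj s \<subseteq>\<^sub>m proj t"
    if st: "s \<in> nodes lam ks" "t \<in> nodes lam ks" "s \<subseteq>\<^sub>m t" for s t
    unfolding map_le_def
  proof
    fix b assume "b \<in> dom (proj s)"
    then have b: "b < lam" "e b \<le> len s" unfolding proj_def by (auto split: if_splits)
    then have "e b \<le> len t" using map_le_len[OF st] by simp
    then show "proj s b = proj t b"
      using b node_colour_extend[of "e b" s t] e(2)[OF b(1)] st unfolding proj_def by simp
  qed
  show ?thesis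
  proof (rule projection_completely_embeds[where \<pi> = "\<lambda>p. proj (stem p)"])
    show "p \<subseteq>\<^sub>m p" for p :: "'a \<rightharpoonup> bool" by simp
    show "r \<subseteq>\<^sub>m p" if "q \<subseteq>\<^sub>m p" "r \<subseteq>\<^sub>m q" for p q r :: "'a \<rightharpoonup> bool"
      using map_le_trans that by blast
    show "proj (stem p) \<in> Add lam" if p: "p \<in> P" for p
    proof -
      have dom: "dom (proj (stem p)) = {b. b < lam \<and> e b \<le> len (stem p)}"
        unfolding proj_def by (auto split: if_splits)
      have "inj_on e (dom (proj (stem p)))" unfolding dom using e(1) by (rule inj_on_subset) auto
      moreover have "countable (e ` dom (proj (stem p)))"
      proof (rule countable_subset)
        show "e ` dom (proj (stem p)) \<subseteq> insert (len (stem p)) {..<len (stem p)}"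
          unfolding dom by auto
        show "countable (insert (len (stem p)) {..<len (stem p)})"
          using segment_countable[OF node_dom(2)[OF stem_node[OF p]]] by simp
      qed
      ultimately have "countable (dom (proj (stem p)))" using countable_image_inj_on by blast
      then show ?thesis unfolding Add_def using dom by auto
    qed
    show "proj (stem p) \<subseteq>\<^sub>m proj (stem q)" if "p \<in> P" "q \<in> P" "q \<subseteq> p" for p q
      using that proj_mono stem_node stem_mono[OF in_LaverD(2)[OF P] stem in_LaverD(2)[OF P] stem] by blast
    show density: "\<exists>p'\<in>P. p' \<subseteq> p \<and> q \<subseteq>\<^sub>m proj (stem p')"
      if p: "p \<in> P" and q: "q \<in> Add lam" "proj (stem p) \<subseteq>\<^sub>m q" for p q
    proof -
      let ?s = "stem p"
      have dq: "dom q \<subseteq> {..<lam}" "countable (dom q)" using q(1) unfolding Add_def by auto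
      have "insert (len ?s) (e ` dom q) \<subseteq> {..<lam}"
        using e(2) dq(1) node_dom(2)[OF stem_node[OF p]] by auto
      then obtain a where a: "a < lam" "\<forall>x\<in>insert (len ?s) (e ` dom q). x < a"
        using countable_bounded_lam[of "insert (len ?s) (e ` dom q)"] dq(2) by auto
      \<comment> \<open>The bits of \<open>q\<close>, transported to limit levels along
        \<open>e\<close>; at levels not coming from \<open>dom q\<close> the value is
        arbitrary.\<close>
      define \<tau> where "\<tau> d = the (q (the_inv_into {..<lam} e d))" for d
      have \<tau>: "\<tau> (e b) = the (q b)" if "b < lam" for b
        unfolding \<tau>_def using the_inv_into_f_f[OF e(1)] that by simp
      obtain t where t: "t \<in> p" "?s \<subseteq>\<^sub>m t" "len t = a"
        "\<forall>d. limit_ordinal d \<and> len ?s < d \<and> d \<le> a \<longrightarrow> node_colour d t = \<tau> d"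
        using colour_extension[OF in_LaverD(1)[OF P p] stem[OF p] a(1) stem_in[OF p] map_le_refl, of \<tau>] a(2)
        by (meson insertI1 less_imp_le)
      have tn: "t \<in> nodes lam ks" using tree_nodes[OF in_LaverD(2)[OF P p] t(1)] .
      have c: "cone p t \<in> P" using cone_in_forcing[OF P p stem[OF p] t(1,2)] .
      have "stem (cone p t) = t" using stem_eq[OF c is_stem_cone[OF stem[OF p] t(1,2)]] .
      moreover have "q \<subseteq>\<^sub>m proj t"
        unfolding map_le_def
      proof
        fix b assume b: "b \<in> dom q"
        then have bl: "b < lam" "e b < a" using dq(1) a(2) by auto
        then have pt: "proj t b = Some (node_colour (e b) t)" unfolding proj_def using t(3) by simp
        show "q b = proj t b"
        proof (cases "e b \<le> len ?s")
          \<comment> \<open>The colour at this level is already decided by the old stem, and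
            \<open>q\<close> agrees with it because it extends \<open>proj ?s\<close>.\<close>
          case True
          then have "b \<in> dom (proj ?s)" using bl unfolding proj_def by auto
          then have "q b = proj ?s b" "proj ?s b = proj t b"
            using q(2) proj_mono[OF stem_node[OF p] tn t(2)] unfolding map_le_def by auto
          then show ?thesis by simp
        next
          case False
          then have "node_colour (e b) t = \<tau> (e b)"
            using t(4) less_imp_le[OF bl(2)] e(2)[OF bl(1)] by (meson not_le)
          then show ?thesis using pt \<tau>[OF bl(1)] b by auto
        qed
      qed
      moreover have "cone p t \<subseteq> p" unfolding cone_def by blast
      ultimately show ?thesis using c by auto
    qed
    show "\<exists>p\<in>P. q \<subseteq>\<^sub>m proj (stem p)" if q: "q \<in> Add lam" for q
    proof -
      \<comment> \<open>A stem below the first limit level projects to the empty condition, which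
        every \<open>q\<close> extends; so \<open>density\<close> applies.\<close>
      obtain p s where p: "p \<in> P" "is_stem ks p s" "\<forall>d. limit_ordinal d \<longrightarrow> \<not> d \<le> len s"
        using short_stem_condition[OF P] by blast
      have "proj (stem p) = Map.empty"
        unfolding stem_eq[OF p(1,2)] proj_def using p(3) e(2) by auto
      then show ?thesis using density[OF p(1) q] by auto
    qed
  qed auto
qed

end

theorem theorem3p11:
  fixes lam :: "'a::wellorder"
    and ks :: "'a \<Rightarrow> 'a"
    and P :: "('a \<rightharpoonup> 'a) set set"
  assumes "singular_cardinal (whole_rel :: 'a rel)"
    and "has_cofinality (whole_rel :: 'a rel) (cardSuc natLeq)"
    and "below_rel lam =o cardSuc natLeq"
    and "strict_mono_on {..<lam} ks"
    and "\<forall>a<lam. regular_cardinal (below_rel (ks a))"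
    and "\<forall>b. \<exists>a<lam. b < ks a"
    and "P \<in> {Laver lam ks, Laver_stat lam ks, Laver_club lam ks}"
  shows "completely_embeds (Add lam) (\<lambda>q p. p \<subseteq>\<^sub>m q) P (\<subseteq>)"
proof -
  interpret laver_setting lam ks by unfold_locales (use assms(3-5) in auto)
  show ?thesis by (rule Add_completely_embeds[OF assms(7)])
qed

end
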